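(* Let $\bm Y$ given $\bm X=\bm x$ have a finite absolute first moment and let the family of weight functions $\mathrm{J}_\tau(s)$ satisfy condition C1 (stated in the context). Let $\xi_\tau(\bm Y|\bm x)=\int_0^1 Q_{\bm Y|\bm x}(s)\,\mathrm{J}_\tau(s)\,ds$. Then, for any $\tau\in(0,1)$, the following hold. (i) $\xi_\tau(\bm Y|\bm x)$ exists and is a non-decreasing function of $\tau$. Furthermore, if there is an interval $I_u\subset(0,1)$ such that $\mathrm{G}_\tau(u)$ is a (strictly) decreasing function of $\tau$ for all $u\in I_u$, then $\xi_\tau(\bm Y|\bm x)$ is (strictly) increasing in $\tau$, so that the curves for different $\tau$ do not cross. (ii) If the conditional distribution of $\bm Y$ given $\bm X=\bm x$ is symmetric, then $$\xi_\tau(\bm Y|\bm x)-\mathrm{E}(\bm Y|\bm X=\bm x)=\mathrm{E}(\bm Y|\bm X=\bm x)-\xi_{1-\tau}(\bm Y|\bm x),$$ that is, the lower and upper curves are symmetric about the regression mean. Furthermore, if $\mathrm{J}_\tau(s)=1$ for all $s\in[0,1]$, then $\xi_\tau(\bm Y|\bm x)=\mathrm{E}(\bm Y|\bm X=\bm x)$. Consequently, when $\mathrm{J}_{0.5}(s)=1$ for all $s$ (as is usually the case), under symmetry the curves are symmetric about the case $\tau=0.5$. (iii) If $\bm Y=m(\bm X)+\sigma(\bm X)\bm\varepsilon$, where $m(\cdot)$ and $\sigma(\cdot)>0$ are unknown functions and the error random variable $\bm\varepsilon$ has a finite absolute first moment, then $$\xi_\tau(\bm Y|\bm x)=m(\bm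 x)+\sigma(\bm x)\,\xi_\tau(\bm\varepsilon),\qquad \xi_\tau(\bm\varepsilon)=\int_0^1Q_{\bm\varepsilon}(s)\,\mathrm{J}_\tau(s)\,ds,$$ where $Q_{\bm\varepsilon}(s)$ is the quantile function of $\bm\varepsilon$. (In particular, under response homogeneity, i.e. constant $\sigma$, the curves $\bm x\mapsto\xi_\tau(\bm Y|\bm x)$ for different $\tau$ are parallel.) (iv) $\omega_\tau\,\xi_\tau(\bm Y|\bm x)$ is a comonotonically additive coherent risk measure.
   Context: Setting. $\bm Y$ is a real-valued dependent variable and $\bm X$ a vector of covariates in $\mathbb{R}^p$. $F(\cdot|\bm x)$ is the conditional distribution function of $\bm Y$ given $\bm X=\bm x$, with conditional density $f(\cdot|\bm x)$, and $Q_{\bm Y|\bm x}(s)$ is the quantile function of this conditional distribution, so that $F(Q_{\bm Y|\bm x}(s)|\bm x)=s$. For a family of functions $\mathrm{J}_\tau:[0,1]\to\mathbb{R}$, $\tau\in(0,1)$, put $\mathrm{G}_\tau(u)=\int_0^u\mathrm{J}_\tau(s)\,ds$. Put $\omega_\tau=-1$ if $0<\tau\le 1/2$ and $\omega_\tau=1$ if $1/2<\tau<1$. Condition C1 on the family $\mathrm{J}_\tau$: (i) $0\le\mathrm{J}_\tau(s)<\infty$ (positive and bounded) for all $\tau\in(0,1)$, $s\in[0,1]$, and $\int_0^1\mathrm{J}_\tau(s)\,ds=1$; (ii) $\mathrm{J}_\tau(s)=\mathrm{J}_{1-\tau}(1-s)$, and $\mathrm{J}_\tau(s)$ is monotonic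 in $s$: non-increasing for $0<\tau\le1/2$ and non-decreasing for $1/2\le\tau<1$; (iii) $\mathrm{G}_\tau(u)$ is a non-increasing function of $\tau$ for all $u\in(0,1)$. Coherent risk measure (in the sense of Artzner et al.). Fix $\bm x$ and $\tau$ and regard $\rho(\bm Y)=\omega_\tau\xi_\tau(\bm Y|\bm x)$ as a functional of $\bm Y$, all statements being under the conditional law given $\bm X=\bm x$. For $\tau\le1/2$, $\bm Y$ is read as a profit; for $\tau>1/2$, as a loss. Coherence means that for all $\bm Y_1,\bm Y_2$ with finite absolute first moment: (a) monotonicity: if $\bm Y_1\le\bm Y_2$ almost surely, then $\omega_\tau\rho(\bm Y_1)\le\omega_\tau\rho(\bm Y_2)$; (b) translation invariance: $\rho(\bm Y_1+c)=\rho(\bm Y_1)+\omega_\tau c$ for every $c\in\mathbb{R}$; (c) positive homogeneity: $\rho(\lambda\bm Y_1)=\lambda\rho(\bm Y_1)$ for every $\lambda\ge0$; (d) subadditivity: $\rho(\bm Y_1+\bm Y_2)\le\rho(\bm Y_1)+\rho(\bm Y_2)$. Comonotonically additive means $\rho(\bm Y_1+\bm Y_2)=\rho(\bm Y_1)+\rho(\bm Y_2)$ whenever $\bm Y_1,\bm Y_2$ are comonotonic, i.e. $(\bm Y_1(\omega)-\bm Y_1(\omega'))(\bm Y_2(\omega)-\bm Y_2(\omega'))\ge0$ for almost every pair $(\omega,\omega')$.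
   Formalization: In (iii) the error is assumed independent of X, and the formula and parallelism hold for almost every x; or at a given x, the conditional law is concentrated on X=x and gives the error its unconditional law. Without this (iii) fails, e.g. error X+Z with X, Z independent normals. *)

theory Defs
  imports "HOL-Probability.Probability"
begin

(* P x plays the role of the conditional law given X = x, on the whole sample space, so that
   E(Y | X = x) is the integral of Y with respect to P x and the conditional distribution of any
   random variable Z given X = x is its distribution under P x. *)
definition regular_cond_prob ::
    "'w measure \<Rightarrow> ('w \<Rightarrow> real^'p) \<Rightarrow> (real^'p \<Rightarrow> 'w measure) \<Rightarrow> bool" where
  "regular_cond_prob M X P \<longleftrightarrow>
     P \<in> borel \<rightarrow>\<^sub>M prob_algebra M \<and>
     (\<forall>A\<in>sets M. \<forall>B\<in>sets borel.
        emeasure M (A \<inter> (X -` B \<inter> space M)) = (\<integral>\<^sup>+ x\<in>B. emeasure (P x) A \<partial>distr M borel X))"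

(* Generalised inverse of the distribution function. Only the levels 0 < s < 1 are meaningful:
   at s = 0 and possibly s = 1 the value is an unspecified real, which no integral over s sees. *)
definition quantile :: "'w measure \<Rightarrow> ('w \<Rightarrow> real) \<Rightarrow> real \<Rightarrow> real" where
  "quantile N Z s = Inf {y. s \<le> cdf (distr N borel Z) y}"

definition xi_exists :: "(real \<Rightarrow> real \<Rightarrow> real) \<Rightarrow> real \<Rightarrow> 'w measure \<Rightarrow> ('w \<Rightarrow> real) \<Rightarrow> bool" where
  "xi_exists J \<tau> N Z \<longleftrightarrow> set_integrable lborel {0..1} (\<lambda>s. quantile N Z s * J \<tau> s)"

(* xi J t (P x) Y is the conditional quantity of Y given X = x,
   and xi J t M e the unconditional one of e. *)
definition xi :: "(real \<Rightarrow> real \<Rightarrow> real) \<Rightarrow> real \<Rightarrow> 'w measure \<Rightarrow> ('w \<Rightarrow> real) \<Rightarrow> real" where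
  "xi J \<tau> N Z = (LBINT s:{0..1}. quantile N Z s * J \<tau> s)"

definition G :: "(real \<Rightarrow> real \<Rightarrow> real) \<Rightarrow> real \<Rightarrow> real \<Rightarrow> real" where
  "G J \<tau> u = (LBINT s:{0..u}. J \<tau> s)"

definition omega_sign :: "real \<Rightarrow> real" where
  "omega_sign \<tau> = (if \<tau> \<le> 1/2 then - 1 else 1)"

(* The bound on J t may depend on t. *)
definition condition_C1 :: "(real \<Rightarrow> real \<Rightarrow> real) \<Rightarrow> bool" where
  "condition_C1 J \<longleftrightarrow>
     (\<forall>\<tau>\<in>{0<..<1}.
        (\<forall>s\<in>{0..1}. 0 \<le> J \<tau> s) \<and> bounded (J \<tau> ` {0..1}) \<and> (LBINT s:{0..1}. J \<tau> s) = 1) \<and>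
     (\<forall>\<tau>\<in>{0<..<1}. \<forall>s\<in>{0..1}. J \<tau> s = J (1 - \<tau>) (1 - s)) \<and>
     (\<forall>\<tau>. 0 < \<tau> \<and> \<tau> \<le> 1/2 \<longrightarrow> antimono_on {0..1} (J \<tau>)) \<and>
     (\<forall>\<tau>. 1/2 \<le> \<tau> \<and> \<tau> < 1 \<longrightarrow> mono_on {0..1} (J \<tau>)) \<and>
     (\<forall>u\<in>{0<..<1}. antimono_on {0<..<1} (\<lambda>\<tau>. G J \<tau> u))"

definition symmetric_rv :: "'w measure \<Rightarrow> ('w \<Rightarrow> real) \<Rightarrow> bool" where
  "symmetric_rv N Z \<longleftrightarrow>
     (\<exists>c. distr N borel (\<lambda>\<omega>. Z \<omega> - c) = distr N borel (\<lambda>\<omega>. c - Z \<omega>))"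

(* Independence of the generated sigma-algebras; indep_var of the library requires both
   variables to take values in the same type. *)
definition indep_rv ::
    "'w measure \<Rightarrow> ('w \<Rightarrow> 'a::topological_space) \<Rightarrow> ('w \<Rightarrow> 'b::topological_space) \<Rightarrow> bool" where
  "indep_rv M U V \<longleftrightarrow>
     prob_space.indep_set M (sets (vimage_algebra (space M) U borel))
                            (sets (vimage_algebra (space M) V borel))"

definition comonotonic :: "'w measure \<Rightarrow> ('w \<Rightarrow> real) \<Rightarrow> ('w \<Rightarrow> real) \<Rightarrow> bool" where
  "comonotonic N Y1 Y2 \<longleftrightarrow>
     (AE p in N \<Otimes>\<^sub>M N. 0 \<le> (Y1 (fst p) - Y1 (snd p)) * (Y2 (fst p) - Y2 (snd p)))"

(* w = -1 when the variables are read as profits, w = 1 when they are read as losses. *)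
definition coherent_risk_measure ::
    "'w measure \<Rightarrow> real \<Rightarrow> (('w \<Rightarrow> real) \<Rightarrow> real) \<Rightarrow> bool" where
  "coherent_risk_measure N w \<rho> \<longleftrightarrow>
     (\<forall>Y1 Y2. integrable N Y1 \<and> integrable N Y2 \<longrightarrow>
        ((AE \<omega> in N. Y1 \<omega> \<le> Y2 \<omega>) \<longrightarrow> w * \<rho> Y1 \<le> w * \<rho> Y2) \<and>
        (\<forall>c. \<rho> (\<lambda>\<omega>. Y1 \<omega> + c) = \<rho> Y1 + w * c) \<and>
        (\<forall>l\<ge>0. \<rho> (\<lambda>\<omega>. l * Y1 \<omega>) = l * \<rho> Y1) \<and>
        \<rho> (\<lambda>\<omega>. Y1 \<omega> + Y2 \<omega>) \<le> \<rho> Y1 + \<rho> Y2)"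

definition comonotonically_additive ::
    "'w measure \<Rightarrow> (('w \<Rightarrow> real) \<Rightarrow> real) \<Rightarrow> bool" where
  "comonotonically_additive N \<rho> \<longleftrightarrow>
     (\<forall>Y1 Y2. integrable N Y1 \<and> integrable N Y2 \<and> comonotonic N Y1 Y2 \<longrightarrow>
        \<rho> (\<lambda>\<omega>. Y1 \<omega> + Y2 \<omega>) = \<rho> Y1 + \<rho> Y2)"

end

(* On (0,1) with Lebesgue measure the quantile function Q of Z has the law of Z. Everything rests
   on two facts.

   (1) A function g with P(Z < g s) \<le> s \<le> P(Z \<le> g s) for all s in (0,1) agrees with Q almost
   everywhere. This gives the quantiles of -Z, of c + l Z, and of a comonotonic sum.

   (2) If D has integral 0 and nonnegative integrals over all (u,1), then the integral of D h is
   nonnegative for every nondecreasing h, by Fubini over the superlevel sets of h. With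
   D = J_t' - J_t and h = Q this is monotonicity in t. With D = Q_1 + Q_2 - Q_(1+2) and h = J_t
   nondecreasing it is subadditivity; here the integrals of D over (u,1) are nonnegative because
   the integral of Q over (u,1) is the minimum over c of (1 - u) c + E (Z - c)^+. Nonincreasing J_t
   reduces to this case by Z |-> -Z. *)

theory Submission
  imports Defs
begin

section \<open>Quantile functions as random variables on the unit interval\<close>

text \<open>Quantiles cannot be compared level by level: Q_(1+2) may exceed Q_1 + Q_2 at some s and
  fall below it at others. Only tail integrals are ordered, and the monotonicity of the weights is
  what lets the tails decide.

  Strictness in (i) rests on the conditional density. Where Q is constant on I_u, the different
  weights may go unnoticed: for a constant variable \<open>xi\<close> is the same at every \<tau>.
  Without atoms Q increases strictly, so levels of Q filling an interval of positive length cut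
  (0,1) inside I_u.

  For (iii), \<open>P x\<close> must be shown to live on X = x and, under independence, to give the
  error its unconditional law, for almost every x. Each event yields an identity outside its own
  null set of x, so both arguments first reduce to countably many events: a countable basis of the
  topology, and half-lines with rational end points.\<close>

abbreviation unif :: "real measure" where
  "unif \<equiv> restrict_space lborel {0<..<1}"

lemma space_unif: "space unif = {0<..<1}"
  by (simp add: space_restrict_space)

lemma sets_unif: "sets unif = sets (restrict_space borel {0<..<1})"
  by (simp add: sets_restrict_space)

lemma prob_space_unif: "prob_space unif"
  by (auto simp: emeasure_restrict_space space_restrict_space intro!: prob_spaceI)

interpretation unif: prob_space unif
  by (rule prob_space_unif)

lemma measurable_unif_mono:
  assumes "mono_on {0<..<1} (g :: real \<Rightarrow> real)"
  shows "g \<in> borel_measurable unif"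
  using borel_measurable_mono_on_fnc[OF assms]
  by (simp add: measurable_cong_sets[OF sets_unif refl])

lemma measurable_unif_borel: "g \<in> borel_measurable borel \<Longrightarrow> g \<in> borel_measurable unif"
  by (simp add: measurable_restrict_space1)

lemma AE_unif_countable:
  assumes "countable (A :: real set)"
  shows "AE s in unif. s \<notin> A"
proof -
  have "AE s in lborel. s \<notin> A"
    by (rule AE_not_in[OF countable_imp_null_set_lborel[OF assms]])
  then show ?thesis
    by (subst AE_restrict_space_iff) auto
qed

lemma AE_unif_ne: "AE s in unif. s \<noteq> c"
  using AE_unif_countable[of "{c}"] by simp

text \<open>The definitions integrate over the closed interval, but \<open>quantile\<close> is
  meaningful and monotone only on the open one. The end points are dropped here as a null
  set.\<close>

lemma integrable_unit_interval_iff: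
  "set_integrable lborel {0..1} f \<longleftrightarrow> integrable unif (f :: real \<Rightarrow> real)"
proof -
  have "set_integrable lborel {0..1} f \<longleftrightarrow> integrable lborel (\<lambda>s. indicator {0<..<1} s *\<^sub>R f s)"
    unfolding set_integrable_def
    by (rule integrable_discrete_difference[where X = "{0, 1}"]) (auto simp: indicator_def)
  also have "\<dots> \<longleftrightarrow> integrable unif f"
    by (subst integrable_restrict_space) auto
  finally show ?thesis .
qed

lemma integral_unit_interval:
  "(LBINT s:{0..1}. f s) = (\<integral>s. f s \<partial>unif)" for f :: "real \<Rightarrow> real"
proof -
  have "(LBINT s:{0..1}. f s) = (\<integral>s. indicator {0<..<1} s *\<^sub>R f s \<partial>lborel)"
    unfolding set_lebesgue_integral_def
    by (rule integral_discrete_difference[where X = "{0, 1}"]) (auto simp: indicator_def)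
  also have "\<dots> = (\<integral>s. f s \<partial>unif)"
    by (subst integral_restrict_space) auto
  finally show ?thesis .
qed

lemma integrable_unif_indicator:
  assumes "integrable unif (f :: real \<Rightarrow> real)"
  shows "integrable unif (\<lambda>s. f s * indicator {\<alpha><..} s)"
proof (rule Bochner_Integration.integrable_bound[OF assms])
  show "(\<lambda>s. f s * indicator {\<alpha><..} s) \<in> borel_measurable unif"
    by (intro borel_measurable_times borel_measurable_integrable[OF assms] measurable_unif_borel) simp
qed (auto simp: indicator_def)

text \<open>Supplies the substitution of 1 - s for s, which the passage from Z to -Z forces on the
  levels.\<close>

lemma distr_unif_reflect: "distr unif unif (\<lambda>s. 1 - s) = unif"
proof (rule measure_eqI)
  have m: "(\<lambda>s. 1 - s) \<in> measurable unif unif"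
    by (intro measurable_restrict_space3) auto
  fix A assume "A \<in> sets (distr unif unif (\<lambda>s. 1 - s))"
  then have A: "A \<in> sets unif"
    by simp
  then have A': "A \<in> sets borel" "A \<subseteq> {0<..<1}"
    by (auto simp: sets_restrict_space_iff)
  have "(\<lambda>s. 1 - s) -` A \<inter> {0<..<1} = (\<lambda>s. 1 - s) -` A"
    using A'(2) by force
  then have "emeasure (distr unif unif (\<lambda>s. 1 - s)) A = emeasure unif ((\<lambda>s. 1 - s) -` A)"
    using A by (simp add: emeasure_distr[OF m] space_unif)
  also have "\<dots> = emeasure lborel ((\<lambda>s. 1 - s) -` A)"
    using A'(2) by (subst emeasure_restrict_space) force+
  also have "\<dots> = emeasure (distr lborel borel (\<lambda>s. 1 + (-1) * s)) A"
    using A' by (subst emeasure_distr) auto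
  also have "distr lborel borel (\<lambda>s. 1 + (-1) * s) = (lborel :: real measure)"
    using lborel_real_affine[of "-1" 1] by (simp add: density_1)
  finally show "emeasure (distr unif unif (\<lambda>s. 1 - s)) A = emeasure unif A"
    using A' by (simp add: emeasure_restrict_space)
qed simp

lemma integral_unif_reflect:
  fixes f :: "real \<Rightarrow> real"
  assumes "f \<in> borel_measurable unif"
  shows "(\<integral>s. f (1 - s) \<partial>unif) = (\<integral>s. f s \<partial>unif)"
proof -
  have "(\<lambda>s. 1 - s) \<in> measurable unif unif"
    by (intro measurable_restrict_space3) auto
  from integral_distr[OF this assms] show ?thesis
    by (simp add: distr_unif_reflect)
qed

definition quantile_version :: "'w measure \<Rightarrow> ('w \<Rightarrow> real) \<Rightarrow> (real \<Rightarrow> real) \<Rightarrow> bool" where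
  "quantile_version N Z g \<longleftrightarrow>
     (\<forall>s\<in>{0<..<1}. measure N {\<omega>\<in>space N. Z \<omega> < g s} \<le> s \<and> s \<le> measure N {\<omega>\<in>space N. Z \<omega> \<le> g s})"

context prob_space
begin

lemma cdf_distr_eq:
  assumes "Z \<in> borel_measurable M"
  shows "cdf (distr M borel Z) y = prob {\<omega>\<in>space M. Z \<omega> \<le> y}"
  unfolding cdf_def using assms by (subst measure_distr) (auto intro!: arg_cong[where f = prob])

lemma cdf_distribution_distr:
  assumes "Z \<in> borel_measurable M"
  shows "cdf_distribution (distr M borel Z)"
  unfolding cdf_distribution_def using assms by (rule real_distribution_distr)

text \<open>The Galois connection between quantile and distribution function; right continuity makes
  the infimum attained.\<close>

lemma quantile_le_iff:
  assumes "Z \<in> borel_measurable M" "s \<in> {0<..<1}"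
  shows "quantile M Z s \<le> y \<longleftrightarrow> s \<le> prob {\<omega>\<in>space M. Z \<omega> \<le> y}"
proof -
  interpret Z: cdf_distribution "distr M borel Z"
    by (rule cdf_distribution_distr) fact
  show ?thesis
    using Z.pseudoinverse'[rule_format, OF assms(2), of y] assms(1)
    by (simp add: quantile_def cdf_distr_eq)
qed

lemma mono_on_quantile:
  assumes "Z \<in> borel_measurable M"
  shows "mono_on {0<..<1} (quantile M Z)"
proof -
  interpret Z: cdf_distribution "distr M borel Z"
    by (rule cdf_distribution_distr) fact
  show ?thesis
    using Z.mono_I unfolding quantile_def .
qed

lemma distr_quantile:
  assumes "Z \<in> borel_measurable M"
  shows "distr unif borel (quantile M Z) = distr M borel Z"
proof -
  interpret Z: cdf_distribution "distr M borel Z"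
    by (rule cdf_distribution_distr) fact
  show ?thesis
    using Z.distr_I_eq_M unfolding quantile_def .
qed

lemma measurable_quantile:
  assumes "Z \<in> borel_measurable M"
  shows "quantile M Z \<in> borel_measurable unif"
  by (intro measurable_unif_mono mono_on_quantile assms)

lemma
  assumes "Z \<in> borel_measurable M" "(h :: real \<Rightarrow> real) \<in> borel_measurable borel"
  shows integrable_comp_quantile_iff:
      "integrable unif (\<lambda>s. h (quantile M Z s)) \<longleftrightarrow> integrable M (\<lambda>\<omega>. h (Z \<omega>))"
    and integral_comp_quantile:
      "(\<integral>s. h (quantile M Z s) \<partial>unif) = (\<integral>\<omega>. h (Z \<omega>) \<partial>M)"
proof -
  have "integrable unif (\<lambda>s. h (quantile M Z s)) \<longleftrightarrow> integrable (distr unif borel (quantile M Z)) h"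
    by (rule integrable_distr_eq[symmetric]) (rule measurable_quantile assms)+
  also have "distr unif borel (quantile M Z) = distr M borel Z"
    by (rule distr_quantile) (rule assms)
  also have "integrable (distr M borel Z) h \<longleftrightarrow> integrable M (\<lambda>\<omega>. h (Z \<omega>))"
    by (rule integrable_distr_eq) (rule assms)+
  finally show "integrable unif (\<lambda>s. h (quantile M Z s)) \<longleftrightarrow> integrable M (\<lambda>\<omega>. h (Z \<omega>))" .
  have "(\<integral>s. h (quantile M Z s) \<partial>unif) = (\<integral>y. h y \<partial>distr unif borel (quantile M Z))"
    by (rule integral_distr[symmetric]) (rule measurable_quantile assms)+
  also have "distr unif borel (quantile M Z) = distr M borel Z"
    by (rule distr_quantile) (rule assms)
  also have "(\<integral>y. h y \<partial>distr M borel Z) = (\<integral>\<omega>. h (Z \<omega>) \<partial>M)"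
    by (rule integral_distr) (rule assms)+
  finally show "(\<integral>s. h (quantile M Z s) \<partial>unif) = (\<integral>\<omega>. h (Z \<omega>) \<partial>M)" .
qed

lemma integrable_quantile:
  assumes "integrable M Z"
  shows "integrable unif (quantile M Z)"
  using assms by (subst integrable_comp_quantile_iff[of Z "\<lambda>y. y"]) auto

lemma integral_quantile:
  assumes "Z \<in> borel_measurable M"
  shows "(\<integral>s. quantile M Z s \<partial>unif) = (\<integral>\<omega>. Z \<omega> \<partial>M)"
  by (rule integral_comp_quantile[of Z "\<lambda>y. y"]) (use assms in auto)

lemma quantile_version_quantile:
  assumes Z[measurable]: "Z \<in> borel_measurable M"
  shows "quantile_version M Z (quantile M Z)"
  unfolding quantile_version_def
proof (intro ballI conjI)
  fix s :: real assume s: "s \<in> {0<..<1}"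
  show "s \<le> prob {\<omega>\<in>space M. Z \<omega> \<le> quantile M Z s}"
    using quantile_le_iff[OF Z s] by blast
  let ?q = "quantile M Z s"
  \<comment> \<open>No point strictly below the quantile has reached the level s, so each event
    \<open>?A n\<close> has probability at most s. These events increase to Z < \<open>?q\<close>,
    and the bound passes to the limit.\<close>
  let ?A = "\<lambda>n::nat. {\<omega>\<in>space M. Z \<omega> \<le> ?q - 1 / Suc n}"
  have "?q - 1 / Suc m \<le> ?q - 1 / Suc n" if "m \<le> n" for m n
    using that by (simp add: frac_le)
  then have "(\<lambda>n. prob (?A n)) \<longlonglongrightarrow> prob (\<Union>n. ?A n)"
    by (intro finite_Lim_measure_incseq) (fastforce simp: incseq_def simp del: of_nat_Suc)+
  also have "(\<Union>n. ?A n) = {\<omega>\<in>space M. Z \<omega> < ?q}"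
  proof (intro set_eqI iffI)
    fix \<omega> assume "\<omega> \<in> {\<omega>\<in>space M. Z \<omega> < ?q}"
    then obtain n where "\<omega> \<in> space M" "inverse (real (Suc n)) < ?q - Z \<omega>"
      using reals_Archimedean[of "?q - Z \<omega>"] by auto
    then show "\<omega> \<in> (\<Union>n. ?A n)"
      by (auto intro!: exI[of _ n] simp: inverse_eq_divide)
  next
    fix \<omega> assume "\<omega> \<in> (\<Union>n. ?A n)"
    then obtain n where n: "\<omega> \<in> space M" "Z \<omega> \<le> ?q - 1 / Suc n"
      by auto
    moreover have "0 < 1 / real (Suc n)"
      by simp
    ultimately have "Z \<omega> < ?q"
      by linarith
    with n(1) show "\<omega> \<in> {\<omega>\<in>space M. Z \<omega> < ?q}"
      by simp
  qed
  finally show "prob {\<omega>\<in>space M. Z \<omega> < ?q} \<le> s"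
  proof (rule LIMSEQ_le_const2)
    have "prob (?A n) \<le> s" for n
      using quantile_le_iff[OF Z s, of "?q - 1 / Suc n"] by (simp del: of_nat_Suc)
    then show "\<exists>N. \<forall>n\<ge>N. prob (?A n) \<le> s"
      by blast
  qed
qed

text \<open>A version is squeezed between the quantile function and its right limit, and these differ
  only at the countably many jumps.\<close>
lemma quantile_version_AE_eq:
  assumes Z[measurable]: "Z \<in> borel_measurable M" and g: "quantile_version M Z g"
  shows "AE s in unif. quantile M Z s = g s"
proof -
  let ?Q = "quantile M Z"
  have lower: "?Q s \<le> g s" if "s \<in> {0<..<1}" for s
    using that g by (simp add: quantile_le_iff[OF Z that] quantile_version_def)
  have upper: "g s \<le> ?Q t" if "s \<in> {0<..<1}" "t \<in> {0<..<1}" "s < t" for s t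
  proof (rule ccontr)
    assume "\<not> g s \<le> ?Q t"
    then have "prob {\<omega>\<in>space M. Z \<omega> \<le> ?Q t} \<le> prob {\<omega>\<in>space M. Z \<omega> < g s}"
      by (intro finite_measure_mono) auto
    moreover have "t \<le> prob {\<omega>\<in>space M. Z \<omega> \<le> ?Q t}"
      using quantile_version_quantile[OF Z] that(2) by (simp add: quantile_version_def)
    moreover have "prob {\<omega>\<in>space M. Z \<omega> < g s} \<le> s"
      using g that(1) by (simp add: quantile_version_def)
    ultimately show False
      using that(3) by linarith
  qed
  have "AE s in unif. s \<notin> {a \<in> {0<..<1}. \<not> isCont ?Q a}"
    by (intro AE_unif_countable mono_on_ctble_discont_open mono_on_quantile) auto
  then show ?thesis
    using AE_space
  proof eventually_elim
    case (elim s)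
    then have s: "s \<in> {0<..<1}" "isCont ?Q s"
      by (auto simp: space_unif)
    have "g s \<le> ?Q s"
    proof (rule tendsto_lowerbound)
      show "(?Q \<longlongrightarrow> ?Q s) (at_right s)"
        using s(2) by (simp add: isCont_def filterlim_at_split)
      show "\<forall>\<^sub>F t in at_right s. g s \<le> ?Q t"
        unfolding eventually_at_right_field
        by (rule exI[of _ 1]) (use s(1) upper[OF s(1)] in simp)
    qed simp
    with lower[OF s(1)] show ?case
      by simp
  qed
qed

end

section \<open>Integrals against monotone functions\<close>

text \<open>The signed length of the levels between b and a: the layer-cake formula in a form that
  also converges for negative values. The version with absolute values computes the norm that Fubini
  asks for.\<close>

lemma
  fixes a b :: real
  shows integrable_level_diff: "integrable lborel (\<lambda>t. of_bool (t < a) - of_bool (t < b) :: real)"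
    and integral_level_diff: "(\<integral>t. of_bool (t < a) - of_bool (t < b) \<partial>lborel) = a - b"
    and integral_abs_level_diff: "(\<integral>t. \<bar>of_bool (t < a) - of_bool (t < b)\<bar> \<partial>lborel) = \<bar>a - b\<bar>"
proof -
  have eq: "(\<lambda>t. of_bool (t < a) - of_bool (t < b) :: real) =
      (\<lambda>t. indicator {b..<a} t - indicator {a..<b} t)"
    by (auto simp: fun_eq_iff indicator_def)
  have eq_abs: "(\<lambda>t. \<bar>of_bool (t < a) - of_bool (t < b)\<bar> :: real) =
      (\<lambda>t. indicator {b..<a} t + indicator {a..<b} t)"
    by (auto simp: fun_eq_iff indicator_def)
  have int: "integrable lborel (indicator {c..<d} :: real \<Rightarrow> real)" for c d :: real
    by (rule integrable_real_indicator) (cases "c \<le> d"; simp)+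
  have val: "measure lborel {c..<d} = max 0 (d - c)" for c d :: real
    by (cases "c \<le> d") simp_all
  show "integrable lborel (\<lambda>t. of_bool (t < a) - of_bool (t < b) :: real)"
    unfolding eq by (intro Bochner_Integration.integrable_diff int)
  show "(\<integral>t. of_bool (t < a) - of_bool (t < b) \<partial>lborel) = a - b"
    unfolding eq by (subst Bochner_Integration.integral_diff) (auto simp: int val)
  show "(\<integral>t. \<bar>of_bool (t < a) - of_bool (t < b)\<bar> \<partial>lborel) = \<bar>a - b\<bar>"
    unfolding eq_abs by (subst Bochner_Integration.integral_add) (auto simp: int val)
qed

text \<open>An upper set of (0,1) is a ray, up to the question whether it contains its end
  point.\<close>

lemma up_closed_unit_interval:
  fixes V :: "real set"
  assumes up: "\<And>s t. \<lbrakk>s \<in> {0<..<1}; t \<in> {0<..<1}; s \<le> t; s \<in> V\<rbrakk> \<Longrightarrow> t \<in> V"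
  obtains \<alpha> where "\<alpha> \<in> {0..1}" "\<And>s. \<lbrakk>s \<in> {0<..<1}; \<alpha> < s\<rbrakk> \<Longrightarrow> s \<in> V"
    "\<And>s. \<lbrakk>s \<in> {0<..<1}; s \<in> V\<rbrakk> \<Longrightarrow> \<alpha> \<le> s"
proof
  \<comment> \<open>Inserting 1 keeps the set nonempty, so that an empty V yields \<alpha> =
    1.\<close>
  let ?W = "insert 1 (V \<inter> {0<..<1})"
  have bdd: "bdd_below ?W"
    by (rule bdd_belowI[of _ 0]) auto
  show "Inf ?W \<in> {0..1}"
    using cInf_lower[OF _ bdd, of 1] by (auto intro!: cInf_greatest)
  show "s \<in> V" if s: "s \<in> {0<..<1}" and less: "Inf ?W < s" for s
  proof -
    have "\<exists>w\<in>?W. w < s"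
      by (rule cInf_lessD[OF _ less]) simp
    then obtain w where "w \<in> ?W" "w < s" ..
    with up[of w s] s show ?thesis
      by auto
  qed
  show "Inf ?W \<le> s" if "s \<in> {0<..<1}" "s \<in> V" for s
    using that by (intro cInf_lower bdd) auto
qed

section \<open>Layers of a monotone function as tails of the unit interval\<close>

context
  fixes D h :: "real \<Rightarrow> real"
  assumes D: "integrable unif D"
    and h: "mono_on {0<..<1} h"
    and Dh: "integrable unif (\<lambda>s. D s * h s)"
    and D0: "(\<integral>s. D s \<partial>unif) = 0"
begin

text \<open>Fubini for \<open>h s - h (1/2)\<close>, written as an integral of indicators of \<open>t < h s\<close>.\<close>
lemma
  shows integrable_layer: "integrable lborel (\<lambda>t. \<integral>s. D s * of_bool (t < h s) \<partial>unif)"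
    and integral_layer: "(\<integral>s. D s * h s \<partial>unif) = (\<integral>t. (\<integral>s. D s * of_bool (t < h s) \<partial>unif) \<partial>lborel)"
proof -
  interpret pair_sigma_finite unif lborel
    by (simp add: pair_sigma_finite_def unif.sigma_finite_measure_axioms sigma_finite_lborel)
  note [measurable] = borel_measurable_integrable[OF D] measurable_unif_mono[OF h]
  \<comment> \<open>The indicator of t < h s alone is not integrable in t, and h may be unbounded
    near 0 and 1. Subtracting the layer at one inner point makes k integrable; it disappears again
    on integrating over s, because D has integral 0.\<close>
  define k where "k = (\<lambda>s t. D s * (of_bool (t < h s) - of_bool (t < h (1/2))))"
  have cut: "integrable unif (\<lambda>s. D s * of_bool (t < h s))" for t
    by (rule Bochner_Integration.integrable_bound[OF D]) auto
  have k_snd: "(\<integral>s. k s t \<partial>unif) = (\<integral>s. D s * of_bool (t < h s) \<partial>unif)" for t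
    using cut D D0 by (simp add: k_def right_diff_distrib)
  have k_fst: "(\<integral>t. k s t \<partial>lborel) = D s * h s - h (1/2) * D s" for s
  proof -
    have "(\<integral>t. k s t \<partial>lborel) = D s * (h s - h (1/2))"
      unfolding k_def Bochner_Integration.integral_mult_right_zero integral_level_diff ..
    then show ?thesis
      by (simp add: algebra_simps)
  qed
  have k_abs: "(\<integral>t. norm (k s t) \<partial>lborel) = norm (D s * h s - h (1/2) * D s)" for s
  proof -
    have "(\<integral>t. norm (k s t) \<partial>lborel) = \<bar>D s\<bar> * \<bar>h s - h (1/2)\<bar>"
      unfolding k_def real_norm_def abs_mult
        Bochner_Integration.integral_mult_right_zero integral_abs_level_diff ..
    then show ?thesis
      by (simp add: algebra_simps flip: abs_mult)
  qed
  have k: "integrable (unif \<Otimes>\<^sub>M lborel) (case_prod k)"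
  proof (intro Fubini_integrable)
    show "case_prod k \<in> borel_measurable (unif \<Otimes>\<^sub>M lborel)"
      unfolding k_def by measurable
    show "AE s in unif. integrable lborel (\<lambda>t. case (s, t) of (s, t) \<Rightarrow> k s t)"
      unfolding k_def using integrable_level_diff by auto
    show "integrable unif (\<lambda>s. \<integral>t. norm (case (s, t) of (s, t) \<Rightarrow> k s t) \<partial>lborel)"
      unfolding case_prod_conv k_abs using D Dh
      by (intro integrable_norm Bochner_Integration.integrable_diff) auto
  qed
  show "integrable lborel (\<lambda>t. \<integral>s. D s * of_bool (t < h s) \<partial>unif)"
    using integrable_snd[OF k] by (simp add: k_snd)
  show "(\<integral>s. D s * h s \<partial>unif) = (\<integral>t. (\<integral>s. D s * of_bool (t < h s) \<partial>unif) \<partial>lborel)"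
    using Fubini_integral[OF k] D Dh D0 by (simp add: k_snd k_fst)
qed

text \<open>As h is nondecreasing, t < h s describes an upper ray of levels s, up to its end point.
  The last two conclusions locate that end point; strict positivity depends on knowing where it
  lies.\<close>

lemma layer_eq_tail:
  obtains \<alpha> where "\<alpha> \<in> {0..1}"
    "(\<integral>s. D s * of_bool (t < h s) \<partial>unif) = (\<integral>s. D s * indicator {\<alpha><..} s \<partial>unif)"
    "\<And>s. \<lbrakk>s \<in> {0<..<1}; h s \<le> t\<rbrakk> \<Longrightarrow> s \<le> \<alpha>"
    "\<And>s. \<lbrakk>s \<in> {0<..<1}; t < h s\<rbrakk> \<Longrightarrow> \<alpha> \<le> s"
proof (rule up_closed_unit_interval[of "{s. t < h s}"])
  note [measurable] = borel_measurable_integrable[OF D] measurable_unif_mono[OF h]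
  show "b \<in> {s. t < h s}" if "a \<in> {0<..<1}" "b \<in> {0<..<1}" "a \<le> b" "a \<in> {s. t < h s}" for a b
    using mono_onD[OF h that(1-3)] that(4) by simp
  fix \<alpha> assume \<alpha>: "\<alpha> \<in> {0..1}" "\<And>s. \<lbrakk>s \<in> {0<..<1}; \<alpha> < s\<rbrakk> \<Longrightarrow> s \<in> {s. t < h s}"
    "\<And>s. \<lbrakk>s \<in> {0<..<1}; s \<in> {s. t < h s}\<rbrakk> \<Longrightarrow> \<alpha> \<le> s"
  have [measurable]: "indicator {\<alpha><..} \<in> borel_measurable unif"
    by (rule measurable_unif_borel) simp
  have "AE s in unif. D s * of_bool (t < h s) = D s * indicator {\<alpha><..} s"
    using AE_space AE_unif_ne[of \<alpha>]
  proof eventually_elim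
    case (elim s)
    then show ?case
      using \<alpha>(2,3)[of s] by (auto simp: space_unif indicator_def)
  qed
  then have "(\<integral>s. D s * of_bool (t < h s) \<partial>unif) = (\<integral>s. D s * indicator {\<alpha><..} s \<partial>unif)"
    by (intro integral_cong_AE) auto
  with \<alpha> show thesis
    by (intro that[of \<alpha>]) force+
qed

text \<open>What remains are the cut points outside \<open>tail\<close>: at \<alpha> = 0 the tail is
  the whole integral of D, which vanishes, and at \<alpha> = 1 nothing of (0,1) is left.\<close>

lemma layer_nonneg:
  assumes tail: "\<And>\<alpha>. \<alpha> \<in> {0<..<1} \<Longrightarrow> 0 \<le> (\<integral>s. D s * indicator {\<alpha><..} s \<partial>unif)"
  shows "0 \<le> (\<integral>s. D s * of_bool (t < h s) \<partial>unif)"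
proof (rule layer_eq_tail[of t])
  fix \<alpha> :: real assume "\<alpha> \<in> {0..1}"
    and eq: "(\<integral>s. D s * of_bool (t < h s) \<partial>unif) = (\<integral>s. D s * indicator {\<alpha><..} s \<partial>unif)"
  then consider "\<alpha> = 0" | "\<alpha> = 1" | "\<alpha> \<in> {0<..<1}"
    unfolding atLeastAtMost_iff greaterThanLessThan_iff by linarith
  then show ?thesis
    unfolding eq
  proof cases
    case 1
    then have "(\<integral>s. D s * indicator {\<alpha><..} s \<partial>unif) = (\<integral>s. D s \<partial>unif)"
      by (intro Bochner_Integration.integral_cong) (auto simp: space_unif)
    with D0 show "0 \<le> (\<integral>s. D s * indicator {\<alpha><..} s \<partial>unif)"
      by simp
  next
    case 2
    then have "(\<integral>s. D s * indicator {\<alpha><..} s \<partial>unif) = (\<integral>s. 0 \<partial>unif)"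
      by (intro Bochner_Integration.integral_cong) (auto simp: space_unif)
    then show "0 \<le> (\<integral>s. D s * indicator {\<alpha><..} s \<partial>unif)"
      by simp
  next
    case 3
    then show "0 \<le> (\<integral>s. D s * indicator {\<alpha><..} s \<partial>unif)"
      by (rule tail)
  qed
qed

lemma integral_mult_mono_nonneg:
  assumes "\<And>\<alpha>. \<alpha> \<in> {0<..<1} \<Longrightarrow> 0 \<le> (\<integral>s. D s * indicator {\<alpha><..} s \<partial>unif)"
  shows "0 \<le> (\<integral>s. D s * h s \<partial>unif)"
  unfolding integral_layer
  by (intro integral_nonneg_AE AE_I2 layer_nonneg assms)

text \<open>For t from h p up to but excluding h q, the superlevel set of h is cut at a point of
  [p,q], so its layer is positive. Such t fill an interval of positive length, and no other layer is
  negative.\<close>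

lemma integral_mult_mono_pos:
  assumes nonneg: "\<And>\<alpha>. \<alpha> \<in> {0<..<1} \<Longrightarrow> 0 \<le> (\<integral>s. D s * indicator {\<alpha><..} s \<partial>unif)"
    and pos: "\<And>\<alpha>. \<alpha> \<in> {p..q} \<Longrightarrow> 0 < (\<integral>s. D s * indicator {\<alpha><..} s \<partial>unif)"
    and pq: "p \<in> {0<..<1}" "q \<in> {0<..<1}" "h p < h q"
  shows "0 < (\<integral>s. D s * h s \<partial>unif)"
proof -
  let ?\<Phi> = "\<lambda>t. \<integral>s. D s * of_bool (t < h s) \<partial>unif"
  have \<Phi>_nonneg: "0 \<le> ?\<Phi> t" for t
    by (intro layer_nonneg nonneg)
  have "?\<Phi> t \<noteq> 0" if "t \<in> {h p..<h q}" for t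
  proof (rule layer_eq_tail[of t])
    fix \<alpha> assume \<alpha>: "\<alpha> \<in> {0..1}" "?\<Phi> t = (\<integral>s. D s * indicator {\<alpha><..} s \<partial>unif)"
      "\<And>s. \<lbrakk>s \<in> {0<..<1}; h s \<le> t\<rbrakk> \<Longrightarrow> s \<le> \<alpha>"
      "\<And>s. \<lbrakk>s \<in> {0<..<1}; t < h s\<rbrakk> \<Longrightarrow> \<alpha> \<le> s"
    then have "\<alpha> \<in> {p..q}"
      using pq that by auto
    then show ?thesis
      using pos[of \<alpha>] \<alpha>(2) by simp
  qed
  then have sub: "{h p..<h q} \<subseteq> {t \<in> space lborel. ?\<Phi> t \<noteq> 0}"
    by auto
  have "(\<integral>t. ?\<Phi> t \<partial>lborel) \<noteq> 0"
  proof
    assume "(\<integral>t. ?\<Phi> t \<partial>lborel) = 0"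
    then have "AE t in lborel. ?\<Phi> t = 0"
      using integral_nonneg_eq_0_iff_AE[OF integrable_layer] \<Phi>_nonneg by simp
    then have "AE t in lborel. t \<notin> {h p..<h q}"
      using sub by (auto elim!: eventually_mono)
    then have "emeasure lborel {h p..<h q} = 0"
      by (subst (asm) AE_iff_measurable[where N = "{h p..<h q}"]) auto
    with pq(3) show False
      by simp
  qed
  moreover have "0 \<le> (\<integral>t. ?\<Phi> t \<partial>lborel)"
    by (rule Bochner_Integration.integral_nonneg) (rule \<Phi>_nonneg)
  ultimately show ?thesis
    unfolding integral_layer by simp
qed

end

section \<open>Tails of quantile functions and comonotonicity\<close>

context prob_space
begin

text \<open>The Rockafellar--Uryasev formula for the conditional value at risk.\<close>
lemma
  assumes Z: "integrable M Z"
  shows tail_quantile_le: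
      "(\<integral>s. quantile M Z s * indicator {\<alpha><..} s \<partial>unif) \<le>
        c * (\<integral>s. indicator {\<alpha><..} s \<partial>unif) + (\<integral>\<omega>. max 0 (Z \<omega> - c) \<partial>M)"
    and tail_quantile_eq: "\<alpha> \<in> {0<..<1} \<Longrightarrow>
      (\<integral>s. quantile M Z s * indicator {\<alpha><..} s \<partial>unif) =
        quantile M Z \<alpha> * (\<integral>s. indicator {\<alpha><..} s \<partial>unif)
          + (\<integral>\<omega>. max 0 (Z \<omega> - quantile M Z \<alpha>) \<partial>M)"
proof -
  note [measurable] = borel_measurable_integrable[OF Z]
  note Q = integrable_quantile[OF Z]
  note [measurable] = borel_measurable_integrable[OF Q]
  have [measurable]: "(indicator {\<alpha><..} :: real \<Rightarrow> real) \<in> borel_measurable unif"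
    by (rule measurable_unif_borel) simp
  have ind: "integrable unif (indicator {\<alpha><..} :: real \<Rightarrow> real)"
    by (rule unif.integrable_const_bound[of _ 1]) auto
  have Qi: "integrable unif (\<lambda>s. quantile M Z s * indicator {\<alpha><..} s)"
    by (rule integrable_unif_indicator[OF Q])
  have exc: "integrable unif (\<lambda>s. max 0 (quantile M Z s - c))" for c
    using Q by (intro integrable_max) auto
  have exc_eq: "(\<integral>s. max 0 (quantile M Z s - c) \<partial>unif) = (\<integral>\<omega>. max 0 (Z \<omega> - c) \<partial>M)" for c
    by (rule integral_comp_quantile) auto
  have diff: "(\<integral>s. (quantile M Z s - c) * indicator {\<alpha><..} s \<partial>unif) =
      (\<integral>s. quantile M Z s * indicator {\<alpha><..} s \<partial>unif) - c * (\<integral>s. indicator {\<alpha><..} s \<partial>unif)" for c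
    using Qi ind by (simp add: left_diff_distrib)
  have "(\<integral>s. (quantile M Z s - c) * indicator {\<alpha><..} s \<partial>unif) \<le> (\<integral>s. max 0 (quantile M Z s - c) \<partial>unif)"
  proof (rule integral_mono)
    show "integrable unif (\<lambda>s. (quantile M Z s - c) * indicator {\<alpha><..} s)"
      unfolding left_diff_distrib using Qi ind by (intro Bochner_Integration.integrable_diff) auto
  qed (auto simp: indicator_def intro: exc)
  then show "(\<integral>s. quantile M Z s * indicator {\<alpha><..} s \<partial>unif) \<le>
      c * (\<integral>s. indicator {\<alpha><..} s \<partial>unif) + (\<integral>\<omega>. max 0 (Z \<omega> - c) \<partial>M)"
    unfolding diff exc_eq by linarith
  assume \<alpha>: "\<alpha> \<in> {0<..<1}"
  let ?q = "quantile M Z \<alpha>"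
  \<comment> \<open>By monotonicity, the quantile function minus \<open>?q\<close> is nonnegative
    beyond \<alpha> and nonpositive up to it, so the indicator cuts out exactly the positive part.
    Another constant c in place of \<open>?q\<close> gives only the inequality above.\<close>
  have "(\<integral>s. (quantile M Z s - ?q) * indicator {\<alpha><..} s \<partial>unif) = (\<integral>s. max 0 (quantile M Z s - ?q) \<partial>unif)"
  proof (intro Bochner_Integration.integral_cong refl)
    fix s assume "s \<in> space unif"
    then show "(quantile M Z s - ?q) * indicator {\<alpha><..} s = max 0 (quantile M Z s - ?q)"
      using mono_onD[OF mono_on_quantile, of Z \<alpha> s] mono_onD[OF mono_on_quantile, of Z s \<alpha>] \<alpha>
      by (cases "\<alpha> < s") (auto simp: space_unif)
  qed
  then show "(\<integral>s. quantile M Z s * indicator {\<alpha><..} s \<partial>unif) =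
      ?q * (\<integral>s. indicator {\<alpha><..} s \<partial>unif) + (\<integral>\<omega>. max 0 (Z \<omega> - ?q) \<partial>M)"
    unfolding diff exc_eq by linarith
qed

lemma tail_quantile_add_le:
  assumes Y: "integrable M Y1" "integrable M Y2" and \<alpha>: "\<alpha> \<in> {0<..<1}"
  shows "(\<integral>s. quantile M (\<lambda>\<omega>. Y1 \<omega> + Y2 \<omega>) s * indicator {\<alpha><..} s \<partial>unif) \<le>
    (\<integral>s. quantile M Y1 s * indicator {\<alpha><..} s \<partial>unif)
      + (\<integral>s. quantile M Y2 s * indicator {\<alpha><..} s \<partial>unif)"
proof -
  let ?c1 = "quantile M Y1 \<alpha>" and ?c2 = "quantile M Y2 \<alpha>"
  have exc: "integrable M (\<lambda>\<omega>. max 0 (Z \<omega> - c))" if "integrable M Z" for Z :: "'a \<Rightarrow> real" and c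
    using that by (intro integrable_max) auto
  \<comment> \<open>The sum of the two minimisers serves as a trial constant for Y1 + Y2, where the
    inequality suffices; the positive part is subadditive.\<close>
  have "(\<integral>\<omega>. max 0 (Y1 \<omega> + Y2 \<omega> - (?c1 + ?c2)) \<partial>M) \<le>
      (\<integral>\<omega>. max 0 (Y1 \<omega> - ?c1) + max 0 (Y2 \<omega> - ?c2) \<partial>M)"
    using Y by (intro integral_mono Bochner_Integration.integrable_add exc) auto
  also have "\<dots> = (\<integral>\<omega>. max 0 (Y1 \<omega> - ?c1) \<partial>M) + (\<integral>\<omega>. max 0 (Y2 \<omega> - ?c2) \<partial>M)"
    using Y by (intro Bochner_Integration.integral_add exc)
  finally show ?thesis
    using tail_quantile_le[of "\<lambda>\<omega>. Y1 \<omega> + Y2 \<omega>" \<alpha> "?c1 + ?c2"] Y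
      tail_quantile_eq[OF Y(1) \<alpha>] tail_quantile_eq[OF Y(2) \<alpha>]
    by (simp add: distrib_right)
qed

text \<open>Upper level sets of comonotonic variables are nested up to null sets. If both inclusions
  failed, they would fail on sets A and B of positive probability; every pair in A \<times> B is
  strictly discordant, and A \<times> B has positive product measure.\<close>

lemma comonotonic_up_closed:
  assumes Y[measurable]: "Y1 \<in> borel_measurable M" "Y2 \<in> borel_measurable M"
    and co: "comonotonic M Y1 Y2"
    and U[measurable]: "U1 \<in> sets borel" "U2 \<in> sets borel"
    and up: "\<And>x y. \<lbrakk>x \<in> U1; x \<le> y\<rbrakk> \<Longrightarrow> y \<in> U1" "\<And>x y. \<lbrakk>x \<in> U2; x \<le> y\<rbrakk> \<Longrightarrow> y \<in> U2"
  shows "(AE \<omega> in M. Y1 \<omega> \<in> U1 \<longrightarrow> Y2 \<omega> \<in> U2) \<or> (AE \<omega> in M. Y2 \<omega> \<in> U2 \<longrightarrow> Y1 \<omega> \<in> U1)"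
proof -
  define A where "A = {\<omega>\<in>space M. \<not> (Y1 \<omega> \<in> U1 \<longrightarrow> Y2 \<omega> \<in> U2)}"
  define B where "B = {\<omega>\<in>space M. \<not> (Y2 \<omega> \<in> U2 \<longrightarrow> Y1 \<omega> \<in> U1)}"
  have [measurable]: "A \<in> sets M" "B \<in> sets M"
    by (simp_all add: A_def B_def)
  have "(Y1 a - Y1 b) * (Y2 a - Y2 b) < 0" if "a \<in> A" "b \<in> B" for a b
  proof -
    have "Y1 b < Y1 a" "Y2 a < Y2 b"
      using that up(1)[of "Y1 a" "Y1 b"] up(2)[of "Y2 b" "Y2 a"]
      by (force simp: A_def B_def)+
    then show ?thesis
      by (simp add: mult_less_0_iff)
  qed
  then have "AE p in M \<Otimes>\<^sub>M M. p \<notin> A \<times> B"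
    using co unfolding comonotonic_def by (force elim!: eventually_mono)
  then have "emeasure (M \<Otimes>\<^sub>M M) (A \<times> B) = 0"
    by (subst (asm) AE_iff_measurable[where N = "A \<times> B"])
      (auto simp: space_pair_measure A_def B_def)
  then have "emeasure M A * emeasure M B = 0"
    by (subst (asm) emeasure_pair_measure_Times) auto
  then show ?thesis
    by (auto simp: A_def B_def AE_iff_measurable[OF _ refl])
qed

text \<open>With nested upper level sets, a single one of the two variables controls on which side
  of the threshold c1 + c2 the sum falls.\<close>

lemma quantile_version_add_comonotonic:
  assumes Y[measurable]: "Y1 \<in> borel_measurable M" "Y2 \<in> borel_measurable M"
    and co: "comonotonic M Y1 Y2"
  shows "quantile_version M (\<lambda>\<omega>. Y1 \<omega> + Y2 \<omega>) (\<lambda>s. quantile M Y1 s + quantile M Y2 s)"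
  unfolding quantile_version_def
proof (intro ballI conjI)
  fix s :: real assume s: "s \<in> {0<..<1}"
  let ?c1 = "quantile M Y1 s" and ?c2 = "quantile M Y2 s"
  have 1: "prob {\<omega>\<in>space M. Y1 \<omega> < ?c1} \<le> s" "s \<le> prob {\<omega>\<in>space M. Y1 \<omega> \<le> ?c1}"
    and 2: "prob {\<omega>\<in>space M. Y2 \<omega> < ?c2} \<le> s" "s \<le> prob {\<omega>\<in>space M. Y2 \<omega> \<le> ?c2}"
    using quantile_version_quantile[OF Y(1)] quantile_version_quantile[OF Y(2)] s
    by (auto simp: quantile_version_def)
  consider "AE \<omega> in M. Y1 \<omega> \<in> {?c1..} \<longrightarrow> Y2 \<omega> \<in> {?c2..}"
    | "AE \<omega> in M. Y2 \<omega> \<in> {?c2..} \<longrightarrow> Y1 \<omega> \<in> {?c1..}"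
    using comonotonic_up_closed[OF Y co, of "{?c1..}" "{?c2..}"] by auto
  then show "prob {\<omega>\<in>space M. Y1 \<omega> + Y2 \<omega> < ?c1 + ?c2} \<le> s"
  proof cases
    case 1
    then have "prob {\<omega>\<in>space M. Y1 \<omega> + Y2 \<omega> < ?c1 + ?c2} \<le> prob {\<omega>\<in>space M. Y1 \<omega> < ?c1}"
      by (intro finite_measure_mono_AE) (auto elim!: eventually_mono)
    with \<open>prob {\<omega>\<in>space M. Y1 \<omega> < ?c1} \<le> s\<close> show ?thesis
      by linarith
  next
    case 2
    then have "prob {\<omega>\<in>space M. Y1 \<omega> + Y2 \<omega> < ?c1 + ?c2} \<le> prob {\<omega>\<in>space M. Y2 \<omega> < ?c2}"
      by (intro finite_measure_mono_AE) (auto elim!: eventually_mono)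
    with \<open>prob {\<omega>\<in>space M. Y2 \<omega> < ?c2} \<le> s\<close> show ?thesis
      by linarith
  qed
  \<comment> \<open>Open rays in place of closed ones: their complements are the events Y \<le> c,
    so nesting makes one of these events imply the other, and hence the bound on the sum.\<close>
  consider "AE \<omega> in M. Y1 \<omega> \<in> {?c1<..} \<longrightarrow> Y2 \<omega> \<in> {?c2<..}"
    | "AE \<omega> in M. Y2 \<omega> \<in> {?c2<..} \<longrightarrow> Y1 \<omega> \<in> {?c1<..}"
    using comonotonic_up_closed[OF Y co, of "{?c1<..}" "{?c2<..}"] by auto
  then show "s \<le> prob {\<omega>\<in>space M. Y1 \<omega> + Y2 \<omega> \<le> ?c1 + ?c2}"
  proof cases
    case 1
    then have "prob {\<omega>\<in>space M. Y2 \<omega> \<le> ?c2} \<le> prob {\<omega>\<in>space M. Y1 \<omega> + Y2 \<omega> \<le> ?c1 + ?c2}"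
      by (intro finite_measure_mono_AE) (auto elim!: eventually_mono)
    with \<open>s \<le> prob {\<omega>\<in>space M. Y2 \<omega> \<le> ?c2}\<close> show ?thesis
      by linarith
  next
    case 2
    then have "prob {\<omega>\<in>space M. Y1 \<omega> \<le> ?c1} \<le> prob {\<omega>\<in>space M. Y1 \<omega> + Y2 \<omega> \<le> ?c1 + ?c2}"
      by (intro finite_measure_mono_AE) (auto elim!: eventually_mono)
    with \<open>s \<le> prob {\<omega>\<in>space M. Y1 \<omega> \<le> ?c1}\<close> show ?thesis
      by linarith
  qed
qed

text \<open>Negation turns lower quantiles into upper ones, so the function given here is the upper
  quantile of -Z and may differ from \<open>quantile\<close> at countably many levels.\<close>

lemma quantile_version_uminus:
  assumes Z[measurable]: "Z \<in> borel_measurable M"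
  shows "quantile_version M (\<lambda>\<omega>. - Z \<omega>) (\<lambda>s. - quantile M Z (1 - s))"
  unfolding quantile_version_def
proof (intro ballI conjI)
  fix s :: real assume "s \<in> {0<..<1}"
  then have s: "1 - s \<in> {0<..<1}"
    by simp
  let ?q = "quantile M Z (1 - s)"
  have "{\<omega>\<in>space M. - Z \<omega> < - ?q} = space M - {\<omega>\<in>space M. Z \<omega> \<le> ?q}"
    "{\<omega>\<in>space M. - Z \<omega> \<le> - ?q} = space M - {\<omega>\<in>space M. Z \<omega> < ?q}"
    by auto
  then show "prob {\<omega>\<in>space M. - Z \<omega> < - ?q} \<le> s" "s \<le> prob {\<omega>\<in>space M. - Z \<omega> \<le> - ?q}"
    using quantile_version_quantile[OF Z, unfolded quantile_version_def, rule_format, OF s]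
    by (simp_all add: prob_compl)
qed

lemma quantile_version_affine:
  assumes Z: "Z \<in> borel_measurable M" and "0 \<le> l"
  shows "quantile_version M (\<lambda>\<omega>. c + l * Z \<omega>) (\<lambda>s. c + l * quantile M Z s)"
proof (cases "l = 0")
  case True
  then show ?thesis
    by (auto simp: quantile_version_def prob_space)
next
  case False
  then show ?thesis
    using quantile_version_quantile[OF Z] \<open>0 \<le> l\<close> by (auto simp: quantile_version_def)
qed

end

section \<open>Weighted quantile integrals\<close>

lemma xi_eq_unif: "xi J \<tau> N Z = (\<integral>s. quantile N Z s * J \<tau> s \<partial>unif)"
  unfolding xi_def by (rule integral_unit_interval)

text \<open>Law invariance, by which values of \<open>xi\<close> are carried between Z - c and c - Z
  and between \<open>P x\<close> and \<open>M\<close>.\<close>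

lemma xi_distr_cong: "distr N borel Z = distr N' borel Z' \<Longrightarrow> xi J \<tau> N Z = xi J \<tau> N' Z'"
  by (simp add: xi_def quantile_def)

context
  fixes J :: "real \<Rightarrow> real \<Rightarrow> real" and \<tau> :: real
  assumes C1: "condition_C1 J" and \<tau>: "\<tau> \<in> {0<..<1}"
begin

lemma C1_nonneg: "s \<in> {0..1} \<Longrightarrow> 0 \<le> J \<tau> s"
  using C1 \<tau> unfolding condition_C1_def by blast

lemma C1_reflect: "s \<in> {0..1} \<Longrightarrow> J \<tau> s = J (1 - \<tau>) (1 - s)"
  using C1 \<tau> unfolding condition_C1_def by blast

lemma C1_antimono: "\<tau> \<le> 1/2 \<Longrightarrow> antimono_on {0..1} (J \<tau>)"
  using C1 \<tau> unfolding condition_C1_def greaterThanLessThan_iff by blast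

lemma C1_mono: "1/2 \<le> \<tau> \<Longrightarrow> mono_on {0..1} (J \<tau>)"
  using C1 \<tau> unfolding condition_C1_def greaterThanLessThan_iff by blast

lemma C1_bounded:
  obtains B where "\<And>s. s \<in> {0<..<1} \<Longrightarrow> \<bar>J \<tau> s\<bar> \<le> B"
proof -
  have "bounded (J \<tau> ` {0..1})"
    using C1 \<tau> unfolding condition_C1_def by blast
  then obtain B where B: "\<forall>x\<in>J \<tau> ` {0..1}. norm x \<le> B"
    unfolding bounded_iff ..
  have "\<bar>J \<tau> s\<bar> \<le> B" if "s \<in> {0<..<1}" for s
    using B that by simp
  then show thesis
    by (rule that)
qed

text \<open>Condition C1 does not speak of measurability; monotonicity supplies it, in opposite
  directions on the two ranges of \<tau>.\<close>

lemma C1_measurable: "J \<tau> \<in> borel_measurable unif"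
proof (cases "\<tau> \<le> 1/2")
  case True
  have "(\<lambda>s. - J \<tau> s) \<in> borel_measurable unif"
    by (intro measurable_unif_mono) (use C1_antimono[OF True] in \<open>auto simp: monotone_on_def\<close>)
  then show ?thesis
    using borel_measurable_uminus_eq[of "J \<tau>"] by simp
next
  case False
  then show ?thesis
    by (intro measurable_unif_mono) (use C1_mono in \<open>auto simp: monotone_on_def\<close>)
qed

lemma C1_integrable_mult:
  assumes "integrable unif f"
  shows "integrable unif (\<lambda>s. f s * J \<tau> s)"
proof -
  obtain B where B: "\<And>s. s \<in> {0<..<1} \<Longrightarrow> \<bar>J \<tau> s\<bar> \<le> B"
    using C1_bounded by blast
  show ?thesis
  proof (rule Bochner_Integration.integrable_bound)
    show "integrable unif (\<lambda>s. B * f s)"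
      using assms by simp
    show "AE s in unif. norm (f s * J \<tau> s) \<le> norm (B * f s)"
    proof (rule AE_I2)
      fix s assume "s \<in> space unif"
      then have "\<bar>J \<tau> s\<bar> \<le> \<bar>B\<bar>"
        using B[of s] by (simp add: space_unif)
      from mult_left_mono[OF this, of "\<bar>f s\<bar>"] show "norm (f s * J \<tau> s) \<le> norm (B * f s)"
        by (simp add: abs_mult mult.commute)
    qed
  qed (use assms C1_measurable in measurable)
qed

lemma C1_integrable: "integrable unif (J \<tau>)"
  using C1_integrable_mult[of "\<lambda>_. 1"] by simp

lemma C1_integral: "(\<integral>s. J \<tau> s \<partial>unif) = 1"
  using C1 \<tau> unfolding condition_C1_def integral_unit_interval by blast

text \<open>Total mass 1 makes upper tails complementary to \<open>G\<close>, so the decrease of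
  \<open>G\<close> in \<tau> becomes an increase of the tails.\<close>

lemma C1_tail:
  assumes u: "u \<in> {0<..<1}"
  shows "(\<integral>s. J \<tau> s * indicator {u<..} s \<partial>unif) = 1 - G J \<tau> u"
proof -
  note [measurable] = C1_measurable
  have [measurable]: "(indicator {..u} :: real \<Rightarrow> real) \<in> borel_measurable unif"
    by (rule measurable_unif_borel) simp
  have "integrable unif (indicator {..u} :: real \<Rightarrow> real)"
    by (rule unif.integrable_const_bound[of _ 1]) auto
  from C1_integrable_mult[OF this] have int: "integrable unif (\<lambda>s. J \<tau> s * indicator {..u} s)"
    by (simp add: mult.commute)
  have "G J \<tau> u = (LBINT s:{0..1}. J \<tau> s * indicator {..u} s)"
    unfolding G_def set_lebesgue_integral_def
    using u by (intro Bochner_Integration.integral_cong) (auto simp: indicator_def)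
  also have "\<dots> = (\<integral>s. J \<tau> s * indicator {..u} s \<partial>unif)"
    by (rule integral_unit_interval)
  finally have "1 - G J \<tau> u = (\<integral>s. J \<tau> s - J \<tau> s * indicator {..u} s \<partial>unif)"
    using C1_integrable C1_integral int by simp
  also have "\<dots> = (\<integral>s. J \<tau> s * indicator {u<..} s \<partial>unif)"
    by (intro Bochner_Integration.integral_cong) (auto simp: indicator_def)
  finally show ?thesis ..
qed

end

section \<open>The functional \<open>xi\<close> at a fixed level\<close>

context prob_space
begin

context
  fixes J :: "real \<Rightarrow> real \<Rightarrow> real" and \<tau> :: real
  assumes C1: "condition_C1 J" and \<tau>: "\<tau> \<in> {0<..<1}"
begin

lemma integrable_xi: "integrable M Z \<Longrightarrow> integrable unif (\<lambda>s. quantile M Z s * J \<tau> s)"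
  by (intro C1_integrable_mult[OF C1 \<tau>] integrable_quantile)

lemma xi_quantile_version:
  assumes "Z \<in> borel_measurable M" "quantile_version M Z g" "g \<in> borel_measurable unif"
  shows "xi J \<tau> M Z = (\<integral>s. g s * J \<tau> s \<partial>unif)"
  unfolding xi_eq_unif
proof (rule integral_cong_AE)
  show "AE s in unif. quantile M Z s * J \<tau> s = g s * J \<tau> s"
    using quantile_version_AE_eq[OF assms(1,2)] by eventually_elim simp
qed (use assms measurable_quantile C1_measurable[OF C1 \<tau>] in measurable)

lemma xi_mono:
  assumes Y: "integrable M Y1" "integrable M Y2" and le: "AE \<omega> in M. Y1 \<omega> \<le> Y2 \<omega>"
  shows "xi J \<tau> M Y1 \<le> xi J \<tau> M Y2"
  unfolding xi_eq_unif
proof (rule integral_mono)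
  fix s assume "s \<in> space unif"
  then have s: "s \<in> {0<..<1}"
    by (simp add: space_unif)
  note [measurable] = borel_measurable_integrable[OF Y(1)] borel_measurable_integrable[OF Y(2)]
  have "s \<le> prob {\<omega>\<in>space M. Y2 \<omega> \<le> quantile M Y2 s}"
    using quantile_le_iff[of Y2 s "quantile M Y2 s"] s by simp
  also have "\<dots> \<le> prob {\<omega>\<in>space M. Y1 \<omega> \<le> quantile M Y2 s}"
    using le by (intro finite_measure_mono_AE) (auto elim!: eventually_mono)
  finally have "quantile M Y1 s \<le> quantile M Y2 s"
    using quantile_le_iff[of Y1 s] s by simp
  then show "quantile M Y1 s * J \<tau> s \<le> quantile M Y2 s * J \<tau> s"
    using C1_nonneg[OF C1 \<tau>, of s] s by (intro mult_right_mono) auto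
qed (rule integrable_xi Y)+

lemma xi_affine:
  assumes Z: "integrable M Z" and l: "0 \<le> l"
  shows "xi J \<tau> M (\<lambda>\<omega>. c + l * Z \<omega>) = c + l * xi J \<tau> M Z"
proof -
  have "xi J \<tau> M (\<lambda>\<omega>. c + l * Z \<omega>) = (\<integral>s. (c + l * quantile M Z s) * J \<tau> s \<partial>unif)"
    using Z l by (intro xi_quantile_version quantile_version_affine) (auto intro!: measurable_quantile borel_measurable_add borel_measurable_times)
  also have "\<dots> = (\<integral>s. c * J \<tau> s + l * (quantile M Z s * J \<tau> s) \<partial>unif)"
    by (simp add: distrib_right mult.assoc)
  also have "\<dots> = c + l * xi J \<tau> M Z"
    using integrable_xi[OF Z] C1_integrable[OF C1 \<tau>] C1_integral[OF C1 \<tau>]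
    by (simp add: xi_eq_unif)
  finally show ?thesis .
qed

lemma xi_add_comonotonic:
  assumes Y: "integrable M Y1" "integrable M Y2" and co: "comonotonic M Y1 Y2"
  shows "xi J \<tau> M (\<lambda>\<omega>. Y1 \<omega> + Y2 \<omega>) = xi J \<tau> M Y1 + xi J \<tau> M Y2"
proof -
  have "xi J \<tau> M (\<lambda>\<omega>. Y1 \<omega> + Y2 \<omega>) = (\<integral>s. (quantile M Y1 s + quantile M Y2 s) * J \<tau> s \<partial>unif)"
    using Y co
    by (intro xi_quantile_version quantile_version_add_comonotonic)
      (auto intro!: measurable_quantile borel_measurable_add)
  also have "\<dots> = xi J \<tau> M Y1 + xi J \<tau> M Y2"
    using integrable_xi[OF Y(1)] integrable_xi[OF Y(2)]
    by (simp add: xi_eq_unif distrib_right)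
  finally show ?thesis .
qed

text \<open>Negation reflects the levels, and the symmetry of the weights in C1 absorbs the
  reflection at the price of replacing \<tau> by 1 - \<tau>.\<close>

lemma xi_uminus:
  assumes Z: "integrable M Z"
  shows "xi J \<tau> M (\<lambda>\<omega>. - Z \<omega>) = - xi J (1 - \<tau>) M Z"
proof -
  have \<tau>': "1 - \<tau> \<in> {0<..<1}"
    using \<tau> by simp
  note [measurable] = borel_measurable_integrable[OF Z] measurable_quantile[of Z]
    C1_measurable[OF C1 \<tau>] C1_measurable[OF C1 \<tau>']
  have [measurable]: "(\<lambda>s. 1 - s) \<in> measurable unif unif"
    by (intro measurable_restrict_space3) auto
  have "xi J \<tau> M (\<lambda>\<omega>. - Z \<omega>) = (\<integral>s. - quantile M Z (1 - s) * J \<tau> s \<partial>unif)"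
    by (intro xi_quantile_version quantile_version_uminus) measurable
  also have "\<dots> = (\<integral>s. - (quantile M Z (1 - s) * J (1 - \<tau>) (1 - s)) \<partial>unif)"
    by (intro Bochner_Integration.integral_cong)
      (auto simp: space_unif C1_reflect[OF C1 \<tau>])
  also have "\<dots> = - (\<integral>s. quantile M Z (1 - s) * J (1 - \<tau>) (1 - s) \<partial>unif)"
    by simp
  also have "\<dots> = - xi J (1 - \<tau>) M Z"
    unfolding xi_eq_unif
    by (subst integral_unif_reflect[of "\<lambda>s. quantile M Z s * J (1 - \<tau>) s"]) auto
  finally show ?thesis .
qed

lemma xi_subadditive:
  assumes Y: "integrable M Y1" "integrable M Y2" and "1/2 \<le> \<tau>"
  shows "xi J \<tau> M (\<lambda>\<omega>. Y1 \<omega> + Y2 \<omega>) \<le> xi J \<tau> M Y1 + xi J \<tau> M Y2"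
proof -
  let ?S = "\<lambda>\<omega>. Y1 \<omega> + Y2 \<omega>"
  let ?D = "\<lambda>s. quantile M Y1 s + quantile M Y2 s - quantile M ?S s"
  have S: "integrable M ?S"
    using Y by simp
  note Q = Y[THEN integrable_quantile] S[THEN integrable_quantile]
  note xi = Y[THEN integrable_xi] S[THEN integrable_xi]
  have lin: "(\<integral>s. f s + g s - h s \<partial>unif) = (\<integral>s. f s \<partial>unif) + (\<integral>s. g s \<partial>unif) - (\<integral>s. h s \<partial>unif)"
    if "integrable unif f" "integrable unif g" "integrable unif h" for f g h :: "real \<Rightarrow> real"
    using that by simp
  have D: "integrable unif ?D"
    by (intro Bochner_Integration.integrable_diff Bochner_Integration.integrable_add Q)
  \<comment> \<open>Each quantile function integrates to a mean, and means are additive; this is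
    where D gets its vanishing integral.\<close>
  have "(\<integral>s. ?D s \<partial>unif) = expectation Y1 + expectation Y2 - expectation ?S"
    unfolding lin[OF Q] by (simp only: integral_quantile Y S borel_measurable_integrable)
  also have "\<dots> = 0"
    using Y by simp
  finally have D0: "(\<integral>s. ?D s \<partial>unif) = 0" .
  have "0 \<le> (\<integral>s. ?D s * J \<tau> s \<partial>unif)"
  proof (rule integral_mult_mono_nonneg[OF D _ C1_integrable_mult[OF C1 \<tau> D] D0])
    show "mono_on {0<..<1} (J \<tau>)"
      using C1_mono[OF C1 \<tau>] \<open>1/2 \<le> \<tau>\<close> by (auto simp: monotone_on_def)
    fix \<alpha> :: real assume \<alpha>: "\<alpha> \<in> {0<..<1}"
    have "(\<integral>s. ?D s * indicator {\<alpha><..} s \<partial>unif) =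
        (\<integral>s. quantile M Y1 s * indicator {\<alpha><..} s \<partial>unif)
          + (\<integral>s. quantile M Y2 s * indicator {\<alpha><..} s \<partial>unif)
          - (\<integral>s. quantile M ?S s * indicator {\<alpha><..} s \<partial>unif)"
      unfolding left_diff_distrib distrib_right by (rule lin[OF Q[THEN integrable_unif_indicator]])
    then show "0 \<le> (\<integral>s. ?D s * indicator {\<alpha><..} s \<partial>unif)"
      using tail_quantile_add_le[OF Y \<alpha>] by simp
  qed
  also have "\<dots> = xi J \<tau> M Y1 + xi J \<tau> M Y2 - xi J \<tau> M ?S"
    unfolding xi_eq_unif left_diff_distrib distrib_right by (rule lin[OF xi])
  finally show ?thesis
    by simp
qed

end

lemma xi_superadditive:
  assumes C1: "condition_C1 J" and \<tau>: "0 < \<tau>" "\<tau> \<le> 1/2"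
    and Y: "integrable M Y1" "integrable M Y2"
  shows "xi J \<tau> M Y1 + xi J \<tau> M Y2 \<le> xi J \<tau> M (\<lambda>\<omega>. Y1 \<omega> + Y2 \<omega>)"
proof -
  have \<tau>': "1 - \<tau> \<in> {0<..<1}"
    using \<tau> by simp
  have "xi J (1 - \<tau>) M (\<lambda>\<omega>. - Y1 \<omega> + - Y2 \<omega>) \<le>
      xi J (1 - \<tau>) M (\<lambda>\<omega>. - Y1 \<omega>) + xi J (1 - \<tau>) M (\<lambda>\<omega>. - Y2 \<omega>)"
    using Y \<tau> by (intro xi_subadditive[OF C1 \<tau>']) auto
  moreover have "xi J (1 - \<tau>) M (\<lambda>\<omega>. - Y1 \<omega> + - Y2 \<omega>) = - xi J \<tau> M (\<lambda>\<omega>. Y1 \<omega> + Y2 \<omega>)"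
    using xi_uminus[OF C1 \<tau>', of "\<lambda>\<omega>. Y1 \<omega> + Y2 \<omega>"] Y by simp
  ultimately show ?thesis
    using xi_uminus[OF C1 \<tau>' Y(1)] xi_uminus[OF C1 \<tau>' Y(2)] by simp
qed

text \<open>For \<tau> \<le> 1/2 the sign -1 turns the superadditivity due to nonincreasing weights
  into subadditivity. In monotonicity the two signs cancel.\<close>

lemma coherent_xi:
  assumes C1: "condition_C1 J" and \<tau>: "\<tau> \<in> {0<..<1}"
  shows "coherent_risk_measure M (omega_sign \<tau>) (\<lambda>Z. omega_sign \<tau> * xi J \<tau> M Z)"
  unfolding coherent_risk_measure_def
proof (intro allI impI conjI, goal_cases)
  case (1 Y1 Y2)
  then show ?case
    using xi_mono[OF C1 \<tau>, of Y1 Y2] by (simp add: omega_sign_def)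
next
  case (2 Y1 Y2 c)
  then show ?case
    using xi_affine[OF C1 \<tau>, of Y1 1 c] by (simp add: omega_sign_def add.commute)
next
  case (3 Y1 Y2 l)
  then show ?case
    using xi_affine[OF C1 \<tau>, of Y1 l 0] by simp
next
  case (4 Y1 Y2)
  then show ?case
    using xi_subadditive[OF C1 \<tau>, of Y1 Y2] xi_superadditive[OF C1, of \<tau> Y1 Y2] \<tau>
    by (auto simp: omega_sign_def)
qed

lemma comonotonically_additive_xi:
  assumes "condition_C1 J" "\<tau> \<in> {0<..<1}"
  shows "comonotonically_additive M (\<lambda>Z. omega_sign \<tau> * xi J \<tau> M Z)"
  unfolding comonotonically_additive_def
  using xi_add_comonotonic[OF assms] by (simp add: distrib_left)

text \<open>Z - c and c - Z share their law, hence their \<open>xi\<close>; the affine and negation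
  rules turn this into symmetry about c. Comparing means identifies c as the expectation.\<close>

lemma xi_symmetric:
  assumes C1: "condition_C1 J" and \<tau>: "\<tau> \<in> {0<..<1}"
    and Z: "integrable M Z" and sym: "symmetric_rv M Z"
  shows "xi J \<tau> M Z - expectation Z = expectation Z - xi J (1 - \<tau>) M Z"
proof -
  obtain c where c: "distr M borel (\<lambda>\<omega>. Z \<omega> - c) = distr M borel (\<lambda>\<omega>. c - Z \<omega>)"
    using sym by (auto simp: symmetric_rv_def)
  have "xi J \<tau> M (\<lambda>\<omega>. Z \<omega> - c) = xi J \<tau> M Z - c"
    using xi_affine[OF C1 \<tau> Z, of 1 "- c"] by simp
  moreover have "xi J \<tau> M (\<lambda>\<omega>. c - Z \<omega>) = c - xi J (1 - \<tau>) M Z"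
    using xi_affine[OF C1 \<tau>, of "\<lambda>\<omega>. - Z \<omega>" 1 c] xi_uminus[OF C1 \<tau> Z] Z by simp
  moreover have "xi J \<tau> M (\<lambda>\<omega>. Z \<omega> - c) = xi J \<tau> M (\<lambda>\<omega>. c - Z \<omega>)"
    by (rule xi_distr_cong[OF c])
  moreover have "(\<integral>\<omega>. Z \<omega> - c \<partial>M) = (\<integral>\<omega>. c - Z \<omega> \<partial>M)"
    using arg_cong[OF c, of "\<lambda>N. \<integral>y. y \<partial>N"] Z by (simp add: integral_distr)
  then have "expectation Z = c"
    using Z by (simp add: prob_space)
  ultimately show ?thesis
    by simp
qed

lemma xi_const_weight:
  assumes "\<forall>s\<in>{0..1}. J \<tau> s = 1" and Z: "Z \<in> borel_measurable M"
  shows "xi J \<tau> M Z = expectation Z"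
proof -
  have "xi J \<tau> M Z = (\<integral>s. quantile M Z s \<partial>unif)"
    unfolding xi_eq_unif
    by (intro Bochner_Integration.integral_cong) (auto simp: space_unif assms(1))
  then show ?thesis
    by (simp add: integral_quantile Z)
qed

section \<open>Dependence on the level \<tau>\<close>

context
  fixes J :: "real \<Rightarrow> real \<Rightarrow> real" and Z :: "'a \<Rightarrow> real" and \<tau> \<tau>' :: real
  assumes C1: "condition_C1 J" and Z: "integrable M Z"
    and \<tau>: "\<tau> \<in> {0<..<1}" and \<tau>': "\<tau>' \<in> {0<..<1}"
begin

lemma integrable_weight_diff: "integrable unif (\<lambda>s. J \<tau>' s - J \<tau> s)"
  using C1_integrable[OF C1 \<tau>] C1_integrable[OF C1 \<tau>'] by simp

lemma integral_weight_diff: "(\<integral>s. J \<tau>' s - J \<tau> s \<partial>unif) = 0"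
  using C1_integrable[OF C1 \<tau>] C1_integrable[OF C1 \<tau>'] C1_integral[OF C1 \<tau>] C1_integral[OF C1 \<tau>']
  by simp

lemma weight_diff_tail:
  assumes u: "u \<in> {0<..<1}"
  shows "(\<integral>s. (J \<tau>' s - J \<tau> s) * indicator {u<..} s \<partial>unif) = G J \<tau> u - G J \<tau>' u"
proof -
  have [measurable]: "(indicator {u<..} :: real \<Rightarrow> real) \<in> borel_measurable unif"
    by (rule measurable_unif_borel) simp
  have "integrable unif (indicator {u<..} :: real \<Rightarrow> real)"
    by (rule unif.integrable_const_bound[of _ 1]) auto
  from C1_integrable_mult[OF C1 \<tau> this] C1_integrable_mult[OF C1 \<tau>' this]
  have "integrable unif (\<lambda>s. J \<tau> s * indicator {u<..} s)"
    "integrable unif (\<lambda>s. J \<tau>' s * indicator {u<..} s)"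
    by (simp_all only: mult.commute)
  from Bochner_Integration.integral_diff[OF this(2,1)] show ?thesis
    unfolding left_diff_distrib C1_tail[OF C1 \<tau> u] C1_tail[OF C1 \<tau>' u] by simp
qed

lemma weight_diff_tail_nonneg:
  assumes "\<tau> \<le> \<tau>'" and u: "u \<in> {0<..<1}"
  shows "0 \<le> (\<integral>s. (J \<tau>' s - J \<tau> s) * indicator {u<..} s \<partial>unif)"
proof -
  have "antimono_on {0<..<1} (\<lambda>\<tau>. G J \<tau> u)"
    using C1 u unfolding condition_C1_def by blast
  then show ?thesis
    using \<tau> \<tau>' assms(1) by (simp add: weight_diff_tail[OF u] monotone_on_def)
qed

lemma integrable_weight_diff_quantile: "integrable unif (\<lambda>s. (J \<tau>' s - J \<tau> s) * quantile M Z s)"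
  using integrable_xi[OF C1 \<tau> Z] integrable_xi[OF C1 \<tau>' Z]
  by (simp add: left_diff_distrib mult.commute[of "quantile M Z _"])

lemma integral_weight_diff_quantile:
  "(\<integral>s. (J \<tau>' s - J \<tau> s) * quantile M Z s \<partial>unif) = xi J \<tau>' M Z - xi J \<tau> M Z"
  using integrable_xi[OF C1 \<tau> Z] integrable_xi[OF C1 \<tau>' Z]
  by (simp add: xi_eq_unif left_diff_distrib mult.commute[of "quantile M Z _"])

lemma xi_mono_level: "\<tau> \<le> \<tau>' \<Longrightarrow> xi J \<tau> M Z \<le> xi J \<tau>' M Z"
  using integral_mult_mono_nonneg[OF integrable_weight_diff
      mono_on_quantile[OF borel_measurable_integrable[OF Z]] integrable_weight_diff_quantile
      integral_weight_diff weight_diff_tail_nonneg]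
  by (simp add: integral_weight_diff_quantile)

lemma xi_strict_mono_level:
  assumes "\<tau> \<le> \<tau>'" and "p \<in> {0<..<1}" "q \<in> {0<..<1}" "quantile M Z p < quantile M Z q"
    and G: "\<And>u. u \<in> {p..q} \<Longrightarrow> G J \<tau>' u < G J \<tau> u"
  shows "xi J \<tau> M Z < xi J \<tau>' M Z"
proof -
  have "0 < (\<integral>s. (J \<tau>' s - J \<tau> s) * quantile M Z s \<partial>unif)"
  proof (rule integral_mult_mono_pos[where p = p and q = q, OF integrable_weight_diff _
        integrable_weight_diff_quantile integral_weight_diff weight_diff_tail_nonneg])
    show "mono_on {0<..<1} (quantile M Z)"
      by (intro mono_on_quantile borel_measurable_integrable Z)
    show "0 < (\<integral>s. (J \<tau>' s - J \<tau> s) * indicator {u<..} s \<partial>unif)" if "u \<in> {p..q}" for u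
      using G[OF that] that assms(2,3) by (subst weight_diff_tail) auto
  qed (use assms in auto)
  then show ?thesis
    by (simp add: integral_weight_diff_quantile)
qed

end

text \<open>Without atoms the distribution function does not exceed p at the quantile of level p, so
  the higher level q is not yet reached there.\<close>

lemma quantile_strict_mono:
  assumes Z[measurable]: "Z \<in> borel_measurable M" and no_atom: "\<And>y. prob {\<omega>\<in>space M. Z \<omega> = y} = 0"
    and pq: "p \<in> {0<..<1}" "q \<in> {0<..<1}" "p < q"
  shows "quantile M Z p < quantile M Z q"
proof -
  have "prob {\<omega>\<in>space M. Z \<omega> \<le> y} = prob {\<omega>\<in>space M. Z \<omega> < y} + prob {\<omega>\<in>space M. Z \<omega> = y}" for y
    by (subst finite_measure_Union[symmetric]) (auto intro!: arg_cong[where f = prob])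
  then have "prob {\<omega>\<in>space M. Z \<omega> \<le> quantile M Z p} \<le> p"
    using quantile_version_quantile[OF Z] pq(1) no_atom by (simp add: quantile_version_def)
  then show ?thesis
    using quantile_le_iff[OF Z pq(2), of "quantile M Z p"] pq(3) by linarith
qed

lemma distributed_lborel_no_atom:
  assumes "distributed M lborel Z f"
  shows "prob {\<omega>\<in>space M. Z \<omega> = y} = 0"
proof -
  have [measurable]: "Z \<in> borel_measurable M" "f \<in> borel_measurable borel"
    using distributed_measurable[OF assms] distributed_borel_measurable[OF assms] by simp_all
  have "emeasure M {\<omega>\<in>space M. Z \<omega> = y} = emeasure (distr M lborel Z) {y}"
    by (subst emeasure_distr) (auto intro!: arg_cong[where f = "emeasure M"])
  also have "\<dots> = (\<integral>\<^sup>+ x. f x * indicator {y} x \<partial>lborel)"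
    by (simp add: distributed_distr_eq_density[OF assms] emeasure_density)
  also have "\<dots> = 0"
    by (intro nn_integral_null_set finite_imp_null_set_lborel) simp
  finally show ?thesis
    by (simp add: measure_def)
qed

end

section \<open>Regular conditional distributions\<close>

context
  fixes M :: "'w measure" and X :: "'w \<Rightarrow> real^'p" and P :: "real^'p \<Rightarrow> 'w measure"
  assumes M: "prob_space M" and X[measurable]: "X \<in> borel_measurable M"
    and P: "regular_cond_prob M X P"
begin

interpretation prob_space M
  by (rule M)

interpretation X: prob_space "distr M borel X"
  by (rule prob_space_distr) (rule X)

text \<open>The kernel takes its values in the probability measures at every x, so results for a
  single probability space apply to each \<open>P x\<close>. Exceptional null sets of x arise only
  where the joint law with X is used.\<close>

lemma
  shows prob_space_cond: "prob_space (P x)" and sets_cond: "sets (P x) = sets M"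
proof -
  have "P \<in> borel \<rightarrow>\<^sub>M prob_algebra M"
    using P by (simp add: regular_cond_prob_def)
  then have "P x \<in> space (prob_algebra M)"
    by (rule measurable_space) simp
  then show "prob_space (P x)" "sets (P x) = sets M"
    by (auto simp: space_prob_algebra)
qed

lemma space_cond: "space (P x) = space M"
  by (rule sets_eq_imp_space_eq) (rule sets_cond)

lemma measurable_cond: "f \<in> measurable M N \<Longrightarrow> f \<in> measurable (P x) N"
  by (simp cong: measurable_cong_sets add: sets_cond)

lemma borel_measurable_cond: "A \<in> sets M \<Longrightarrow> (\<lambda>x. emeasure (P x) A) \<in> borel_measurable borel"
  using P by (intro measurable_compose[OF _ measurable_emeasure_subprob_algebra] measurable_prob_algebraD)
    (auto simp: regular_cond_prob_def)

lemma emeasure_cond: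
  assumes "A \<in> sets M" "B \<in> sets borel"
  shows "emeasure M (A \<inter> (X -` B \<inter> space M)) = (\<integral>\<^sup>+ x\<in>B. emeasure (P x) A \<partial>distr M borel X)"
  using P assms unfolding regular_cond_prob_def by blast

text \<open>The conditional probabilities of a null set average to 0, hence vanish for almost every
  x.\<close>

lemma AE_cond:
  assumes "AE \<omega> in M. Q \<omega>"
  shows "AE x in distr M borel X. AE \<omega> in P x. Q \<omega>"
proof -
  obtain N where N: "{\<omega>\<in>space M. \<not> Q \<omega>} \<subseteq> N" "emeasure M N = 0" "N \<in> sets M"
    using assms by (rule AE_E)
  have "N \<inter> (X -` UNIV \<inter> space M) = N"
    using sets.sets_into_space[OF N(3)] by auto
  then have "(\<integral>\<^sup>+ x. emeasure (P x) N \<partial>distr M borel X) = 0"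
    using emeasure_cond[OF N(3), of UNIV] N(2) by simp
  then have "AE x in distr M borel X. emeasure (P x) N = 0"
    using borel_measurable_cond[OF N(3)] by (subst (asm) nn_integral_0_iff_AE) auto
  then show ?thesis
  proof eventually_elim
    case (elim x)
    show ?case
      using elim N by (intro AE_I[of _ _ N]) (auto simp: space_cond sets_cond)
  qed
qed

text \<open>The density of \<open>B \<mapsto> M (A \<inter> X \<in> B)\<close> with respect to the law of \<open>X\<close> is unique.\<close>
lemma cond_unique:
  assumes A: "A \<in> sets M" and g: "g \<in> borel_measurable borel"
    and eq: "\<And>B. B \<in> sets borel \<Longrightarrow>
      emeasure M (A \<inter> (X -` B \<inter> space M)) = (\<integral>\<^sup>+ x\<in>B. g x \<partial>distr M borel X)"
  shows "AE x in distr M borel X. emeasure (P x) A = g x"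
proof (subst finite_density_unique[symmetric])
  show "(\<lambda>x. emeasure (P x) A) \<in> borel_measurable (distr M borel X)"
    "g \<in> borel_measurable (distr M borel X)"
    using borel_measurable_cond[OF A] g by auto
  have "(\<integral>\<^sup>+ x. emeasure (P x) A \<partial>distr M borel X) = emeasure M (A \<inter> (X -` UNIV \<inter> space M))"
    using emeasure_cond[OF A, of UNIV] by simp
  then show "(\<integral>\<^sup>+ x. emeasure (P x) A \<partial>distr M borel X) \<noteq> \<infinity>"
    by simp
  show "density (distr M borel X) (\<lambda>x. emeasure (P x) A) = density (distr M borel X) g"
    using borel_measurable_cond[OF A] g emeasure_cond[OF A] eq
    by (intro measure_eqI) (auto simp: emeasure_density)
qed auto

text \<open>For a fixed open B, the conditional probability of X \<in> B is the indicator of B at x,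
  almost everywhere. A countable basis lets one null set serve all its members, and these separate x
  from every other value of X.\<close>

lemma AE_cond_X: "AE x in distr M borel X. AE \<omega> in P x. X \<omega> = x"
proof -
  obtain \<B> :: "(real^'p) set set" where \<B>: "countable \<B>" "topological_basis \<B>"
    using ex_countable_basis by blast
  have open_\<B>: "open B" if "B \<in> \<B>" for B
    using topological_basis_open[OF \<B>(2) that] .
  have "AE x in distr M borel X. \<forall>B\<in>\<B>. emeasure (P x) (X -` B \<inter> space M) = indicator B x"
  proof (rule AE_ball_countable'[OF _ \<B>(1)])
    fix B assume "B \<in> \<B>"
    then have [measurable]: "B \<in> sets borel"
      using open_\<B> by auto
    show "AE x in distr M borel X. emeasure (P x) (X -` B \<inter> space M) = indicator B x"
    proof (rule cond_unique)
      fix C :: "(real^'p) set" assume [measurable]: "C \<in> sets borel"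
      have "X -` B \<inter> space M \<inter> (X -` C \<inter> space M) = X -` (B \<inter> C) \<inter> space M"
        by auto
      moreover have "indicator B x * indicator C x = (indicator (B \<inter> C) x :: ennreal)" for x
        by (simp add: indicator_def)
      ultimately show "emeasure M (X -` B \<inter> space M \<inter> (X -` C \<inter> space M)) =
          (\<integral>\<^sup>+ x\<in>C. indicator B x \<partial>distr M borel X)"
        by (simp add: emeasure_distr)
    qed auto
  qed
  then show ?thesis
  proof eventually_elim
    case (elim x)
    have "AE \<omega> in P x. \<forall>B\<in>\<B>. x \<notin> B \<longrightarrow> X \<omega> \<notin> B"
    proof (rule AE_ball_countable'[OF _ \<B>(1)])
      fix B assume B: "B \<in> \<B>"
      show "AE \<omega> in P x. x \<notin> B \<longrightarrow> X \<omega> \<notin> B"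
      proof (cases "x \<in> B")
        case False
        have "X -` B \<inter> space M \<in> sets M"
          using open_\<B>[OF B] by (intro measurable_sets[OF X]) auto
        then show ?thesis
          using elim B False
          by (intro AE_I[of _ _ "X -` B \<inter> space M"]) (auto simp: space_cond sets_cond)
      qed simp
    qed
    then show ?case
    proof eventually_elim
      case (elim \<omega>)
      show ?case
      proof (rule ccontr)
        assume "X \<omega> \<noteq> x"
        then obtain B where "B \<in> \<B>" "X \<omega> \<in> B" "B \<subseteq> - {x}"
          using topological_basisE[OF \<B>(2), of "- {x}" "X \<omega>"] by auto
        with elim show False
          by blast
      qed
    qed
  qed
qed

text \<open>Under independence the constant \<open>emeasure M ?A\<close> is itself a conditional
  probability of the event. Rational thresholds leave a single null set, and right continuity
  extends the equality of distribution functions to all reals.\<close>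

lemma AE_cond_indep:
  fixes V :: "'w \<Rightarrow> real"
  assumes V[measurable]: "V \<in> borel_measurable M" and indep: "indep_rv M X V"
  shows "AE x in distr M borel X. distr (P x) borel V = distr M borel V"
proof -
  have "AE x in distr M borel X. \<forall>q\<in>\<rat>. emeasure (P x) (V -` {..q} \<inter> space M) = emeasure M (V -` {..q} \<inter> space M)"
  proof (rule AE_ball_countable'[OF _ countable_rat])
    fix q :: real
    let ?A = "V -` {..q} \<inter> space M"
    show "AE x in distr M borel X. emeasure (P x) ?A = emeasure M ?A"
    proof (rule cond_unique)
      fix B :: "(real^'p) set" assume [measurable]: "B \<in> sets borel"
      have "prob ((X -` B \<inter> space M) \<inter> ?A) = prob (X -` B \<inter> space M) * prob ?A"
        using indep unfolding indep_rv_def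
        by (rule indep_setD) (auto intro!: in_vimage_algebra)
      then have "emeasure M (?A \<inter> (X -` B \<inter> space M)) = emeasure M ?A * emeasure M (X -` B \<inter> space M)"
        by (simp add: emeasure_eq_measure ennreal_mult Int_commute mult.commute)
      then show "emeasure M (?A \<inter> (X -` B \<inter> space M)) = (\<integral>\<^sup>+ x\<in>B. emeasure M ?A \<partial>distr M borel X)"
        by (simp add: nn_integral_cmult emeasure_distr)
    qed auto
  qed
  then show ?thesis
  proof eventually_elim
    case (elim x)
    interpret x: prob_space "P x"
      by (rule prob_space_cond)
    interpret Vx: real_distribution "distr (P x) borel V"
      by (intro x.real_distribution_distr measurable_cond V)
    interpret V: real_distribution "distr M borel V"
      by (rule real_distribution_distr) (rule V)
    have eq: "cdf (distr (P x) borel V) q = cdf (distr M borel V) q" if "q \<in> \<rat>" for q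
      using elim that measurable_cond[OF V, of x]
      by (simp add: cdf_def measure_def emeasure_distr space_cond)
    have "cdf (distr (P x) borel V) y = cdf (distr M borel V) y" for y
    proof (rule tendsto_unique)
      \<comment> \<open>Rational points strictly above y, so that they converge to y within
        \<open>at_right y\<close>.\<close>
      define r where "r n = (SOME q. q \<in> \<rat> \<and> y < q \<and> q < y + 1 / Suc n)" for n :: nat
      have r: "r n \<in> \<rat> \<and> y < r n \<and> r n < y + 1 / Suc n" for n
        unfolding r_def by (rule someI_ex) (use Rats_dense_in_real[of y "y + 1 / Suc n"] in auto)
      have "(\<lambda>n. y + 1 / Suc n) \<longlonglongrightarrow> y + 0"
        by (intro tendsto_add tendsto_const LIMSEQ_Suc[OF lim_1_over_n])
      then have "r \<longlonglongrightarrow> y"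
        using r by (intro tendsto_sandwich[of "\<lambda>_. y" r _ "\<lambda>n. y + 1 / Suc n"])
          (auto intro!: always_eventually less_imp_le simp del: of_nat_Suc)
      then have lim: "filterlim r (at_right y) sequentially"
        using r by (auto simp: filterlim_at intro!: always_eventually)
      show "(\<lambda>n. cdf (distr M borel V) (r n)) \<longlonglongrightarrow> cdf (distr M borel V) y"
        using V.cdf_is_right_cont lim by (auto simp: continuous_within intro: filterlim_compose)
      show "(\<lambda>n. cdf (distr M borel V) (r n)) \<longlonglongrightarrow> cdf (distr (P x) borel V) y"
        unfolding eq[OF r[THEN conjunct1], symmetric]
        using Vx.cdf_is_right_cont lim by (auto simp: continuous_within intro: filterlim_compose)
    qed simp
    then show ?case
      by (intro cdf_unique ext) unfold_locales
  qed
qed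

text \<open>Given X = x the coefficients freeze to the constants m x and \<sigma> x, so that Y is a
  positive affine image of \<epsilon> under \<open>P x\<close>.\<close>

lemma xi_location_scale:
  assumes C1: "condition_C1 J" and \<tau>: "\<tau> \<in> {0<..<1}"
    and Y: "Y \<in> borel_measurable M" and \<epsilon>: "integrable M \<epsilon>" and \<sigma>: "0 < \<sigma> x"
    and Xx: "AE \<omega> in P x. X \<omega> = x" and d: "distr (P x) borel \<epsilon> = distr M borel \<epsilon>"
    and model: "AE \<omega> in P x. Y \<omega> = m (X \<omega>) + \<sigma> (X \<omega>) * \<epsilon> \<omega>"
  shows "xi J \<tau> (P x) Y = m x + \<sigma> x * xi J \<tau> M \<epsilon>"
proof -
  interpret x: prob_space "P x"
    by (rule prob_space_cond)
  note \<epsilon>_meas = borel_measurable_integrable[OF \<epsilon>]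
  note [measurable] = measurable_cond[OF \<epsilon>_meas, of x] measurable_cond[OF Y, of x]
  \<comment> \<open>Integrability depends on the law alone, which is how it passes from
    \<open>M\<close> to \<open>P x\<close>.\<close>
  have "integrable (distr M borel \<epsilon>) (\<lambda>y. y)"
    using \<epsilon> \<epsilon>_meas by (simp add: integrable_distr_eq)
  then have int: "integrable (P x) \<epsilon>"
    unfolding d[symmetric] by (simp add: integrable_distr_eq)
  have "AE \<omega> in P x. Y \<omega> = m x + \<sigma> x * \<epsilon> \<omega>"
    using Xx model by eventually_elim simp
  then have "distr (P x) borel Y = distr (P x) borel (\<lambda>\<omega>. m x + \<sigma> x * \<epsilon> \<omega>)"
    by (intro distr_cong_AE) auto
  then have "xi J \<tau> (P x) Y = xi J \<tau> (P x) (\<lambda>\<omega>. m x + \<sigma> x * \<epsilon> \<omega>)"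
    by (rule xi_distr_cong)
  also have "\<dots> = m x + \<sigma> x * xi J \<tau> (P x) \<epsilon>"
    using \<sigma> by (intro x.xi_affine[OF C1 \<tau> int]) simp
  also have "xi J \<tau> (P x) \<epsilon> = xi J \<tau> M \<epsilon>"
    by (rule xi_distr_cong[OF d])
  finally show ?thesis .
qed

text \<open>The conditions of the pointwise version do not mention \<tau>, so one null set of x
  serves all levels.\<close>

lemma AE_xi_location_scale:
  assumes C1: "condition_C1 J" and Y: "Y \<in> borel_measurable M" and \<epsilon>: "integrable M \<epsilon>"
    and \<sigma>: "\<And>x. 0 < \<sigma> x" and indep: "indep_rv M X \<epsilon>"
    and model: "AE \<omega> in M. Y \<omega> = m (X \<omega>) + \<sigma> (X \<omega>) * \<epsilon> \<omega>"
  shows "AE x in distr M borel X. \<forall>\<tau>\<in>{0<..<1}. xi J \<tau> (P x) Y = m x + \<sigma> x * xi J \<tau> M \<epsilon>"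
  using AE_cond_X AE_cond_indep[OF borel_measurable_integrable[OF \<epsilon>] indep] AE_cond[OF model]
proof eventually_elim
  case (elim x)
  then show ?case
    using xi_location_scale[where m = m and \<sigma> = \<sigma> and x = x, OF C1 _ Y \<epsilon> \<sigma>] by blast
qed

end

text \<open>A regular conditional probability is determined only up to null sets of x. Part (iii)
  therefore has two forms: at each x where \<open>P x\<close> respects X = x, the model and the law
  of \<epsilon>, and at almost every x as a consequence of independence.\<close>

theorem theorem2p1:
  fixes M :: "'w measure" and X :: "'w \<Rightarrow> real^'p" and P :: "real^'p \<Rightarrow> 'w measure"
    and Y :: "'w \<Rightarrow> real" and f :: "real^'p \<Rightarrow> real \<Rightarrow> ennreal"
    and J :: "real \<Rightarrow> real \<Rightarrow> real"
  assumes M: "prob_space M"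
    and X: "X \<in> borel_measurable M"
    and Y: "Y \<in> borel_measurable M"
    and P: "regular_cond_prob M X P"
    and C1: "condition_C1 J"
  shows
   "(\<forall>x. distributed (P x) lborel Y (f x) \<and> integrable (P x) Y \<longrightarrow>
      \<comment> \<open>(i)\<close>
      (\<forall>\<tau>\<in>{0<..<1}. xi_exists J \<tau> (P x) Y) \<and>
      mono_on {0<..<1} (\<lambda>\<tau>. xi J \<tau> (P x) Y) \<and>
      ((\<exists>a b. a < b \<and> {a<..<b} \<subseteq> {0<..<1} \<and>
          (\<forall>u\<in>{a<..<b}. strict_antimono_on {0<..<1} (\<lambda>\<tau>. G J \<tau> u))) \<longrightarrow>
        strict_mono_on {0<..<1} (\<lambda>\<tau>. xi J \<tau> (P x) Y)) \<and>
      \<comment> \<open>(ii)\<close>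
      (symmetric_rv (P x) Y \<longrightarrow>
        (\<forall>\<tau>\<in>{0<..<1}.
          xi J \<tau> (P x) Y - integral\<^sup>L (P x) Y = integral\<^sup>L (P x) Y - xi J (1 - \<tau>) (P x) Y)) \<and>
      (\<forall>\<tau>\<in>{0<..<1}. (\<forall>s\<in>{0..1}. J \<tau> s = 1) \<longrightarrow> xi J \<tau> (P x) Y = integral\<^sup>L (P x) Y) \<and>
      (symmetric_rv (P x) Y \<and> (\<forall>s\<in>{0..1}. J (1/2) s = 1) \<longrightarrow>
        (\<forall>\<tau>\<in>{0<..<1}.
          xi J \<tau> (P x) Y - xi J (1/2) (P x) Y = xi J (1/2) (P x) Y - xi J (1 - \<tau>) (P x) Y))) \<and>
    \<comment> \<open>(iii)\<close>
    (\<forall>m \<sigma> \<epsilon>. (\<forall>x. 0 < \<sigma> x) \<and> integrable M \<epsilon> \<longrightarrow>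
      (\<forall>x. (AE \<omega> in P x. X \<omega> = x) \<and> distr (P x) borel \<epsilon> = distr M borel \<epsilon> \<and>
           (AE \<omega> in P x. Y \<omega> = m (X \<omega>) + \<sigma> (X \<omega>) * \<epsilon> \<omega>) \<longrightarrow>
         (\<forall>\<tau>\<in>{0<..<1}. xi J \<tau> (P x) Y = m x + \<sigma> x * xi J \<tau> M \<epsilon>)) \<and>
      (indep_rv M X \<epsilon> \<and> (AE \<omega> in M. Y \<omega> = m (X \<omega>) + \<sigma> (X \<omega>) * \<epsilon> \<omega>) \<longrightarrow>
         (AE x in distr M borel X. \<forall>\<tau>\<in>{0<..<1}. xi J \<tau> (P x) Y = m x + \<sigma> x * xi J \<tau> M \<epsilon>) \<and>
         ((\<exists>s0. \<forall>x. \<sigma> x = s0) \<longrightarrow>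
           (\<forall>\<tau>\<in>{0<..<1}. \<forall>\<tau>'\<in>{0<..<1}. \<exists>d. AE x in distr M borel X.
              xi J \<tau> (P x) Y - xi J \<tau>' (P x) Y = d)))) \<and>
    \<comment> \<open>(iv)\<close>
    (\<forall>x. \<forall>\<tau>\<in>{0<..<1}.
      coherent_risk_measure (P x) (omega_sign \<tau>) (\<lambda>Z. omega_sign \<tau> * xi J \<tau> (P x) Z) \<and>
      comonotonically_additive (P x) (\<lambda>Z. omega_sign \<tau> * xi J \<tau> (P x) Z))"
proof (intro conjI allI impI, goal_cases)
  case (1 x)
  interpret prob_space "P x"
    by (rule prob_space_cond[OF M X P])
  have int: "integrable (P x) Y"
    using 1 by blast
  show ?case
    unfolding xi_exists_def integrable_unit_interval_iff using integrable_xi[OF C1 _ int] by blast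
next
  case (2 x)
  interpret prob_space "P x"
    by (rule prob_space_cond[OF M X P])
  show ?case
    using xi_mono_level[OF C1] 2 by (auto simp: monotone_on_def)
next
  case (3 x)
  interpret prob_space "P x"
    by (rule prob_space_cond[OF M X P])
  have int: "integrable (P x) Y" and dist: "distributed (P x) lborel Y (f x)"
    using 3 by auto
  obtain a b where ab: "a < b" "{a<..<b} \<subseteq> {0<..<1}"
    and anti: "\<And>u. u \<in> {a<..<b} \<Longrightarrow> strict_antimono_on {0<..<1} (\<lambda>\<tau>. G J \<tau> u)"
    using 3 by blast
  \<comment> \<open>Strictly inside, because the cut points range over the closed interval from p to
    q and \<open>G\<close> is strictly decreasing in \<tau> only on the open one.\<close>
  obtain p q where pq: "a < p" "p < q" "q < b"
    using ab(1) by (meson dense)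
  then have unit: "p \<in> {0<..<1}" "q \<in> {0<..<1}"
    using ab(2) by (auto simp: subset_iff)
  have Q: "quantile (P x) Y p < quantile (P x) Y q"
    using int distributed_lborel_no_atom[OF dist] unit pq(2)
    by (intro quantile_strict_mono) auto
  show ?case
  proof (rule strict_mono_onI)
    fix \<tau> \<tau>' :: real assume \<tau>: "\<tau> \<in> {0<..<1}" "\<tau>' \<in> {0<..<1}" "\<tau> < \<tau>'"
    show "xi J \<tau> (P x) Y < xi J \<tau>' (P x) Y"
    proof (rule xi_strict_mono_level[OF C1 int \<tau>(1,2) _ unit Q])
      fix u assume "u \<in> {p..q}"
      then have "u \<in> {a<..<b}"
        using pq by auto
      from anti[OF this] show "G J \<tau>' u < G J \<tau> u"
        using \<tau> by (auto simp: monotone_on_def)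
    qed (use \<tau> in simp)
  qed
next
  case (4 x)
  interpret prob_space "P x"
    by (rule prob_space_cond[OF M X P])
  show ?case
    using xi_symmetric[OF C1] 4 by blast
next
  case (5 x)
  interpret prob_space "P x"
    by (rule prob_space_cond[OF M X P])
  show ?case
    using xi_const_weight 5 by blast
next
  case (6 x)
  interpret prob_space "P x"
    by (rule prob_space_cond[OF M X P])
  have int: "integrable (P x) Y" and sym: "symmetric_rv (P x) Y" and one: "\<forall>s\<in>{0..1}. J (1/2) s = 1"
    using 6 by blast+
  show ?case
    \<comment> \<open>Constant weight at 1/2 makes that curve the conditional mean, about which
      symmetry is already known.\<close>
    unfolding xi_const_weight[where J = J and \<tau> = "1/2", OF one borel_measurable_integrable[OF int]]
    using xi_symmetric[OF C1 _ int sym] by blast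
next
  case (7 m \<sigma> \<epsilon> x)
  then show ?case
    using xi_location_scale[where m = m and \<sigma> = \<sigma> and x = x, OF M X P C1 _ Y] by blast
next
  case (8 m \<sigma> \<epsilon>)
  then show ?case
    using AE_xi_location_scale[where m = m and \<sigma> = \<sigma>, OF M X P C1 Y] by blast
next
  case (9 m \<sigma> \<epsilon>)
  then obtain s0 where s0: "\<And>x. \<sigma> x = s0"
    by blast
  have ae: "AE x in distr M borel X. \<forall>\<tau>\<in>{0<..<1}. xi J \<tau> (P x) Y = m x + \<sigma> x * xi J \<tau> M \<epsilon>"
    using AE_xi_location_scale[where m = m and \<sigma> = \<sigma>, OF M X P C1 Y] 9 by blast
  show ?case
  \<comment> \<open>The term m x cancels in the difference, and constant \<sigma> leaves a value
    free of x.\<close>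
  proof (intro ballI exI)
    fix \<tau> \<tau>' :: real assume "\<tau> \<in> {0<..<1}" "\<tau>' \<in> {0<..<1}"
    with ae show "AE x in distr M borel X.
        xi J \<tau> (P x) Y - xi J \<tau>' (P x) Y = s0 * xi J \<tau> M \<epsilon> - s0 * xi J \<tau>' M \<epsilon>"
      by (auto elim!: eventually_mono simp: s0)
  qed
next
  case (10 x)
  interpret prob_space "P x"
    by (rule prob_space_cond[OF M X P])
  show ?case
    using coherent_xi[OF C1] comonotonically_additive_xi[OF C1] by blast
qed

end
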